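(* Let $a\in(0,1)$, $A=1/a$, let $\{\xi_n\}_{n\ge1}$ be i.i.d. positive random variables, $\eta_n=\log_A\xi_n$ with distribution function $F(x)=\mathbf P(\eta_1\le x)$, $X_n=aX_{n-1}+\xi_n$ for $n\ge1$, and $T^{(X)}_{x_0}=\inf\{k\ge1: X_k\le x_0\}$. Assume that $x_0$ is such that $\mathbf P(ax_0+\xi_1\le x_0)>0$. Assume also that $\mathbf E\eta_1<\infty$, that $F\in\mathcal S^*$ and that $$\mathbf P(\eta_1>x)\sim\mathbf P(\eta_1>x-\log x),\qquad x\to\infty.$$ Then, for any $x>x_0$, $$\mathbf P_x\left(T^{(X)}_{x_0}>n\right)\sim\mathbf E_x\left[T^{(X)}_{x_0}\right]\mathbf P(\eta_1>n),\qquad n\to\infty.$$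
   Context: $\mathbf P_x,\mathbf E_x$ refer to the chain started at $X_0=x$. Class $\mathcal S^*$ (strong subexponential distributions): with $\overline F=1-F$, a distribution function $F$ with $\mu_+=\int_0^\infty\overline F(y)\,dy<\infty$ belongs to $\mathcal S^*$ if $\overline F(x)>0$ for all $x$ and $$\frac{\int_0^x\overline F(x-y)\overline F(y)\,dy}{\overline F(x)}\to2\mu_+\qquad\text{as }x\to\infty.$$
   Formalization: If P(ax_0+ξ_1<x_0)=0, then T=∞ a.s. and E_x[T]=∞, so "~" is undefined; there the claim is that P_x(T>n)/P(η_1>n) tends to E_x[T]=∞. Otherwise E_x[T]<∞ and the stated equivalence holds. *)

theory Defs
  imports "HOL-Probability.Probability" "HOL-Library.Landau_Symbols"
begin

definition tail :: "(real \<Rightarrow> real) \<Rightarrow> real \<Rightarrow> real" where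
  "tail F y = 1 - F y"

definition distribution_function :: "(real \<Rightarrow> real) \<Rightarrow> bool" where
  "distribution_function F \<longleftrightarrow> (\<exists>\<mu>. real_distribution \<mu> \<and> F = cdf \<mu>)"

definition strong_subexponential :: "(real \<Rightarrow> real) set" where
  "strong_subexponential = {F. distribution_function F
     \<and> set_integrable lborel {0..} (tail F)
     \<and> (\<forall>x. 0 < tail F x)
     \<and> ((\<lambda>x. (LINT y:{0..x}|lborel. tail F (x - y) * tail F y) / tail F x)
          \<longlongrightarrow> 2 * (LINT y:{0..}|lborel. tail F y)) at_top}"

text \<open>
  The chain started at \<open>x\<close> is realised on the probability space that carries the innovations
  \<open>\<xi> 1, \<xi> 2, \<dots>\<close>; the value of \<open>\<xi> 0\<close> is never used.
\<close>

primrec ar_chain :: "real \<Rightarrow> (nat \<Rightarrow> 'w \<Rightarrow> real) \<Rightarrow> real \<Rightarrow> nat \<Rightarrow> 'w \<Rightarrow> real" where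
  "ar_chain a \<xi> x 0 \<omega> = x"
| "ar_chain a \<xi> x (Suc n) \<omega> = a * ar_chain a \<xi> x n \<omega> + \<xi> (Suc n) \<omega>"

text \<open>The infimum of the empty set is \<open>\<infinity>\<close>.\<close>

definition hitting_time :: "(nat \<Rightarrow> 'w \<Rightarrow> real) \<Rightarrow> real \<Rightarrow> 'w \<Rightarrow> enat" where
  "hitting_time X x0 \<omega> = Inf {enat k | k. 1 \<le> k \<and> X k \<omega> \<le> x0}"

end

theory Submission
  imports Defs "HOL-Real_Asymp.Real_Asymp"
begin

text \<open>
  Write \<open>p n = P(T > n)\<close> and let \<open>\<phi> n = P(\<eta> > n)\<close>.  A single innovation with \<open>\<eta> > n\<close> lifts the
  chain to height at least \<open>a\<^sup>-\<^sup>n\<close>, from where it needs about \<open>n\<close> steps to decay.  The theorem says that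
  this is the only efficient way to survive for \<open>n\<close> steps: the jump happens after \<open>k\<close> steps, for some
  bounded \<open>k\<close>, with the chain alive until then, which gives \<open>\<Sum>k. p k * \<phi> n = E T * \<phi> n\<close>.

  Lower bound.  The events ``alive after \<open>k\<close> steps, and innovation \<open>k + 1\<close> is the first one above
  \<open>x0 / a\<^sup>n\<close>'' are disjoint and force survival up to time \<open>n\<close> (\<open>surv_lower\<close>).  Hence
  \<open>liminf p n / \<phi> n\<close> is at least every partial sum of \<open>\<Sum>k. p k\<close> (\<open>surv_ratio_lower\<close>).  If the chain
  cannot go strictly below \<open>x0\<close> from \<open>x0\<close>, then \<open>p n = 1\<close> for all \<open>n\<close>, the mean is infinite, and this
  bound is already the whole assertion.

  Upper bound, when the chain can go strictly below \<open>x0\<close>.  Fix a level \<open>R\<close>.  If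
  \<open>X\<^sub>n \<le> R\<close>, then \<open>m\<close> consecutive small innovations, an event of probability \<open>\<delta>\<close>, bring the chain down to \<open>x0\<close>.  If \<open>X\<^sub>n > R\<close> and \<open>n\<close> is large, then, because
  \<open>\<Sum>j. 1 / (j + 1)\<^sup>2 \<le> 2\<close>, some innovation \<open>k + 1 \<le> n\<close> exceeds
  \<open>R / 4 / (a\<^sup>j (j + 1)\<^sup>2)\<close> with \<open>j = n - (k + 1)\<close>.  Together this is the renewal-type inequality
  \<open>p (n + m) \<le> (1 - \<delta>) p n + \<delta> \<Sum>k<n. p k f (n - k - 1)\<close> (\<open>surv_recursion\<close>).  On the logarithmic
  scale the factor \<open>(j + 1)\<^sup>2\<close> is a shift by \<open>O(log j)\<close>, so \<open>f j\<close> is at most \<open>(1 + o(1)) \<phi> j\<close> by the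
  insensitivity of the tail (\<open>dominated_jump_tail\<close>), and the total mass of \<open>f\<close> is as small as desired
  when \<open>R\<close> is large (\<open>surv_recursive_bound\<close>).

  The rest is analysis of sequences.  Since \<open>F\<close> is strong subexponential, \<open>\<phi>\<close> is a subexponential
  sequence: convolutions with \<open>\<phi>\<close> are governed by their two ends.  Applied to the inequality this
  yields first that \<open>p\<close> is summable, then that \<open>p n = O(\<phi> n)\<close>, and then
  \<open>limsup p n / \<phi> n \<le> \<Sum>k. p k\<close> (\<open>recursive_bound_limsup\<close>).
\<close>

section \<open>Renewal inequalities for subexponential sequences\<close>

text \<open>
  For a sequence with \<open>\<phi> (n - 1) / \<phi> n \<longlonglongrightarrow> 1\<close>, the assumption \<open>middle\<close> is what
  \<open>(\<phi> * \<phi>) n \<sim> 2 (\<Sum>k. \<phi> k) \<phi> n\<close> amounts to: two big summands are much rarer than one.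
\<close>

locale subexponential_sequence =
  fixes \<phi> :: "nat \<Rightarrow> real"
  assumes pos: "0 < \<phi> n"
    and long_tailed: "0 < \<eta> \<Longrightarrow> \<forall>\<^sub>F n in sequentially. \<phi> (n - i) \<le> (1 + \<eta>) * \<phi> n"
    and middle: "0 < \<epsilon> \<Longrightarrow>
      \<exists>J. \<forall>\<^sub>F n in sequentially. (\<Sum>k\<in>{J..n-J}. \<phi> k * \<phi> (n - k)) \<le> \<epsilon> * \<phi> n"
begin

lemma long_tailed_shift:
  assumes "0 < \<eta>"
  shows "\<forall>\<^sub>F n in sequentially. \<phi> n \<le> (1 + \<eta>) * \<phi> (n + m)"
  using eventually_sequentially_seg[of "\<lambda>n. \<phi> (n - m) \<le> (1 + \<eta>) * \<phi> n" m]
    long_tailed[OF assms, of m] by simp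

definition dominated :: "(nat \<Rightarrow> real) \<Rightarrow> bool" where
  "dominated f \<longleftrightarrow> (\<forall>n. 0 \<le> f n) \<and> summable f
     \<and> (\<forall>\<eta>>0. \<forall>\<^sub>F n in sequentially. f n \<le> (1 + \<eta>) * \<phi> n)"

text \<open>
  One of the indices \<open>k\<close> and \<open>n - k\<close> is bounded, up to a negligible middle part.  If it is \<open>k\<close>, then
  \<open>f (n - k)\<close> is about \<open>\<phi> n\<close> and \<open>p\<close> contributes its total mass; if it is \<open>n - k\<close>, then \<open>p k\<close> is at
  most about \<open>B \<phi> n\<close> and \<open>f\<close> contributes its mass.  The threshold for \<open>n\<close> does not depend on \<open>B\<close>; this
  allows an induction that establishes \<open>p \<le> B \<phi>\<close> itself.
\<close>

lemma convolution_bound: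
  fixes f p :: "nat \<Rightarrow> real"
  assumes f: "dominated f"
    and p0: "\<And>n. 0 \<le> p n" and ps: "summable p" and \<eta>: "0 < \<eta>"
  shows "\<forall>\<^sub>F n in sequentially. \<forall>B\<ge>0. (\<forall>k\<le>n. p k \<le> B * \<phi> k) \<longrightarrow>
    (\<Sum>k\<le>n. p k * f (n - k)) \<le> (suminf p + \<eta> + B * (suminf f + \<eta>)) * \<phi> n"
proof -
  have f0: "0 \<le> f n" for n using f by (auto simp: dominated_def)
  have fs: "summable f" using f by (auto simp: dominated_def)
  have fd: "\<forall>\<^sub>F n in sequentially. f n \<le> (1 + e) * \<phi> n" if "0 < e" for e
    using f that by (auto simp: dominated_def)
  define S where "S = suminf p"
  define s where "s = suminf f"
  have S0: "0 \<le> S" unfolding S_def using ps p0 by (rule suminf_nonneg)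
  have s0: "0 \<le> s" unfolding s_def using fs f0 by (rule suminf_nonneg)
  define e where "e = min 1 (\<eta> / (4 * (S + s + 1)))"
  have e: "0 < e" "e \<le> 1" "e * (4 * (S + s + 1)) \<le> \<eta>"
  proof -
    show "0 < e" "e \<le> 1" using \<eta> S0 s0 by (auto simp: e_def)
    have "e \<le> \<eta> / (4 * (S + s + 1))" by (simp add: e_def)
    then show "e * (4 * (S + s + 1)) \<le> \<eta>" using S0 s0 by (simp add: field_simps)
  qed
  obtain J1 where J1: "\<forall>\<^sub>F n in sequentially. (\<Sum>k\<in>{J1..n-J1}. \<phi> k * \<phi> (n - k)) \<le> \<eta>/4 * \<phi> n"
    using middle[of "\<eta>/4"] \<eta> by auto
  obtain J2 where J2: "\<And>n. n \<ge> J2 \<Longrightarrow> f n \<le> (1 + e) * \<phi> n"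
    using fd[OF e(1)] by (auto simp: eventually_sequentially)
  define J where "J = max J1 J2"
  have ev1: "\<forall>\<^sub>F n in sequentially. \<forall>i<J. \<phi> (n - i) \<le> (1 + e) * \<phi> n"
    using eventually_ball_finite[of "{..<J}" "\<lambda>n i. \<phi> (n - i) \<le> (1 + e) * \<phi> n" sequentially]
      long_tailed[OF e(1)] by (simp add: Ball_def)
  show ?thesis
    using J1 ev1 eventually_ge_at_top[of "2 * J"]
  proof eventually_elim
    case (elim n)
    show ?case
    proof (intro allI impI)
      fix B :: real assume B: "0 \<le> B" and pB: "\<forall>k\<le>n. p k \<le> B * \<phi> k"
      have split: "{..n} = {..<J} \<union> {J..n-J} \<union> {n-J<..n}" using elim(3) by auto
      have "(\<Sum>k\<le>n. p k * f (n - k)) \<le> (\<Sum>k<J. p k * f (n - k))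
          + (\<Sum>k\<in>{J..n-J}. p k * f (n - k)) + (\<Sum>k\<in>{n-J<..n}. p k * f (n - k))"
      proof -
        have "(\<Sum>k\<in>U \<union> V. p k * f (n - k)) \<le> (\<Sum>k\<in>U. p k * f (n - k)) + (\<Sum>k\<in>V. p k * f (n - k))"
          if "finite U" "finite V" for U V :: "nat set"
          using that p0 f0 by (subst sum_Un) (auto intro!: sum_nonneg)
        from this[of "{..<J} \<union> {J..n-J}" "{n-J<..n}"] this[of "{..<J}" "{J..n-J}"]
        show ?thesis unfolding split by simp
      qed
      also have "(\<Sum>k<J. p k * f (n - k)) \<le> (\<Sum>k<J. p k * ((1 + e) * ((1 + e) * \<phi> n)))"
      proof (intro sum_mono mult_left_mono p0)
        fix k assume k: "k \<in> {..<J}"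
        have "f (n - k) \<le> (1 + e) * \<phi> (n - k)"
          by (rule J2) (use k elim(3) in \<open>auto simp: J_def\<close>)
        also have "\<dots> \<le> (1 + e) * ((1 + e) * \<phi> n)"
          using elim(2) k e(1) by (intro mult_left_mono) auto
        finally show "f (n - k) \<le> (1 + e) * ((1 + e) * \<phi> n)" .
      qed
      also have "\<dots> = (\<Sum>k<J. p k) * ((1 + e) * ((1 + e) * \<phi> n))"
        by (simp add: sum_distrib_right)
      also have "\<dots> \<le> S * ((1 + e) * ((1 + e) * \<phi> n))"
        unfolding S_def using ps p0 e(1) pos[of n]
        by (intro mult_right_mono sum_le_suminf) auto
      also have "\<dots> \<le> S * ((1 + 3 * e) * \<phi> n)"
      proof -
        have "e * e \<le> e" using e by (simp add: mult_left_le)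
        then have "(1 + e) * (1 + e) \<le> 1 + 3 * e" by (simp add: algebra_simps)
        then show ?thesis using pos[of n] S0
          by (metis less_eq_real_def mult.assoc mult_left_mono mult_right_mono)
      qed
      also have "\<dots> \<le> (S + \<eta>) * \<phi> n"
      proof -
        have "e * S \<le> e * (S + s + 1)" using S0 s0 e by (intro mult_left_mono) auto
        then have "S * (1 + 3 * e) \<le> S + \<eta>" using e(3) \<eta> by (simp add: algebra_simps)
        then show ?thesis using pos[of n] by (simp add: mult.assoc[symmetric] mult_right_mono)
      qed
      also have "(\<Sum>k\<in>{J..n-J}. p k * f (n - k))
          \<le> (\<Sum>k\<in>{J..n-J}. (B * \<phi> k) * (2 * \<phi> (n - k)))"
      proof (intro sum_mono mult_mono)
        fix k assume k: "k \<in> {J..n-J}"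
        show "p k \<le> B * \<phi> k" using pB k by auto
        have "f (n - k) \<le> (1 + e) * \<phi> (n - k)"
          by (rule J2) (use k elim(3) in \<open>auto simp: J_def\<close>)
        also have "\<dots> \<le> 2 * \<phi> (n - k)" using e pos[of "n - k"] by (intro mult_right_mono) auto
        finally show "f (n - k) \<le> 2 * \<phi> (n - k)" .
        show "0 \<le> B * \<phi> k" using B pos[of k] by simp
      qed (rule f0)
      also have "\<dots> = 2 * B * (\<Sum>k\<in>{J..n-J}. \<phi> k * \<phi> (n - k))"
        by (simp add: sum_distrib_left mult_ac)
      also have "\<dots> \<le> 2 * B * (\<Sum>k\<in>{J1..n-J1}. \<phi> k * \<phi> (n - k))"
        using B pos by (intro mult_left_mono sum_mono2) (auto simp: J_def less_imp_le)
      also have "\<dots> \<le> 2 * B * (\<eta>/4 * \<phi> n)"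
        using elim(1) B by (intro mult_left_mono) auto
      also have "(\<Sum>k\<in>{n-J<..n}. p k * f (n - k)) \<le> (\<Sum>k\<in>{n-J<..n}. B * ((1 + e) * \<phi> n) * f (n - k))"
      proof (intro sum_mono mult_right_mono f0)
        fix k assume k: "k \<in> {n-J<..n}"
        have "p k \<le> B * \<phi> (n - (n - k))" using pB k by auto
        also have "\<dots> \<le> B * ((1 + e) * \<phi> n)"
          using elim(2) k elim(3) B by (intro mult_left_mono elim(2)[rule_format]) auto
        finally show "p k \<le> B * ((1 + e) * \<phi> n)" .
      qed
      also have "\<dots> = B * ((1 + e) * \<phi> n) * (\<Sum>k\<in>{n-J<..n}. f (n - k))"
        by (simp add: sum_distrib_left)
      also have "(\<Sum>k\<in>{n-J<..n}. f (n - k)) = (\<Sum>i<J. f i)"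
        using elim(3)
        by (intro sum.reindex_bij_witness[of _ "\<lambda>i. n - i" "\<lambda>k. n - k"]) auto
      also have "B * ((1 + e) * \<phi> n) * \<dots> \<le> B * ((1 + e) * \<phi> n) * s"
        unfolding s_def using fs f0 B e(1) pos[of n]
        by (intro mult_left_mono sum_le_suminf) auto
      also have "\<dots> = B * (s + e * s) * \<phi> n" by (simp add: algebra_simps)
      also have "\<dots> \<le> B * (s + \<eta>/4) * \<phi> n"
      proof -
        have "e * s \<le> e * (S + s + 1)" using S0 s0 e by (intro mult_left_mono) auto
        then have "e * s \<le> \<eta>/4" using e(3) by (simp add: algebra_simps)
        then show ?thesis using B pos[of n] by (intro mult_right_mono mult_left_mono) auto
      qed
      finally have "(\<Sum>k\<le>n. p k * f (n - k))
          \<le> (S + \<eta>) * \<phi> n + 2 * B * (\<eta>/4 * \<phi> n) + B * (s + \<eta>/4) * \<phi> n" by simp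
      also have "\<dots> = (S + \<eta> + B * (s + 3/4 * \<eta>)) * \<phi> n" by (simp add: algebra_simps)
      also have "\<dots> \<le> (S + \<eta> + B * (s + \<eta>)) * \<phi> n"
        using B \<eta> pos[of n] by (intro mult_right_mono add_left_mono mult_left_mono) auto
      finally show "(\<Sum>k\<le>n. p k * f (n - k)) \<le> (suminf p + \<eta> + B * (suminf f + \<eta>)) * \<phi> n"
        by (simp add: S_def s_def)
    qed
  qed
qed

text \<open>
  In the application \<open>\<delta>\<close> is the probability of a quick death from a bounded state, and \<open>f\<close> bounds the
  probability that the state is still large because of a jump made earlier.
\<close>

definition recursive_bound :: "(nat \<Rightarrow> real) \<Rightarrow> real \<Rightarrow> bool" where
  "recursive_bound p \<epsilon> \<longleftrightarrow> (\<exists>m \<delta> f. 0 < m \<and> 0 < \<delta> \<and> \<delta> \<le> 1 \<and> dominated f \<and> suminf f \<le> \<epsilon> \<and>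
     (\<forall>\<^sub>F n in sequentially. p (n + m) \<le> (1 - \<delta>) * p n + \<delta> * (\<Sum>k\<le>n. p k * f (n - k))))"

text \<open>
  Summing the inequality over \<open>n \<le> N\<close> bounds a partial sum \<open>P\<close> of \<open>p\<close> by
  \<open>C + (1 - \<delta>) P + \<delta> P / 2\<close>, and \<open>P\<close> can be absorbed on the left.
\<close>

lemma recursive_bound_summable:
  assumes p0: "\<And>n. 0 \<le> p n" and rec: "recursive_bound p (1/2)"
  shows "summable p"
proof -
  obtain m \<delta> f where d: "0 < \<delta>" "\<delta> \<le> 1" and f: "dominated f" and fh: "suminf f \<le> 1/2"
    and r: "\<forall>\<^sub>F n in sequentially. p (n + m) \<le> (1 - \<delta>) * p n + \<delta> * (\<Sum>k\<le>n. p k * f (n - k))"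
    using rec by (auto simp: recursive_bound_def)
  have f0: "0 \<le> f n" for n using f by (auto simp: dominated_def)
  have fs: "summable f" using f by (auto simp: dominated_def)
  obtain n0 where n0: "\<And>n. n \<ge> n0 \<Longrightarrow>
      p (n + m) \<le> (1 - \<delta>) * p n + \<delta> * (\<Sum>k\<le>n. p k * f (n - k))"
    using r by (auto simp: eventually_sequentially)
  define C where "C = (\<Sum>n<n0. p (n + m)) + (\<Sum>n<m. p n)"
  have bound: "(\<Sum>n\<le>N. p n) \<le> 2 * C / \<delta>" for N
  proof -
    let ?P = "\<Sum>n\<le>N. p n"
    have g0: "0 \<le> (1 - \<delta>) * p n + \<delta> * (\<Sum>k\<le>n. p k * f (n - k))" for n
      using d p0 f0 by (intro add_nonneg_nonneg mult_nonneg_nonneg sum_nonneg) auto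
    have "?P \<le> (\<Sum>n<m. p n) + (\<Sum>n\<le>N. p (n + m))"
    proof -
      have "?P \<le> (\<Sum>n\<le>N + m. p n)" using p0 by (intro sum_mono2) auto
      also have "{..N + m} = {..<m} \<union> {m..N + m}" by auto
      also have "(\<Sum>n\<in>\<dots>. p n) = (\<Sum>n<m. p n) + (\<Sum>n\<in>{m..N + m}. p n)"
        by (intro sum.union_disjoint) auto
      also have "(\<Sum>n\<in>{m..N + m}. p n) = (\<Sum>n\<le>N. p (n + m))"
        by (rule sum.reindex_bij_witness[of _ "\<lambda>n. n + m" "\<lambda>n. n - m"]) auto
      finally show ?thesis .
    qed
    also have "(\<Sum>n\<le>N. p (n + m)) \<le> (\<Sum>n\<le>N. (if n < n0 then p (n + m) else 0)
        + ((1 - \<delta>) * p n + \<delta> * (\<Sum>k\<le>n. p k * f (n - k))))"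
      using n0 g0 by (intro sum_mono) (auto simp: not_less)
    also have "\<dots> = (\<Sum>n\<le>N. if n < n0 then p (n + m) else 0) + (1 - \<delta>) * ?P
        + \<delta> * (\<Sum>n\<le>N. \<Sum>k\<le>n. p k * f (n - k))"
      by (simp add: sum.distrib sum_distrib_left)
    also have "(\<Sum>n\<le>N. if n < n0 then p (n + m) else 0) \<le> (\<Sum>n<n0. p (n + m))"
    proof -
      have "(\<Sum>n\<le>N. if n < n0 then p (n + m) else 0) = (\<Sum>n\<in>{..N} \<inter> {..<n0}. p (n + m))"
        by (subst sum.inter_restrict) auto
      also have "\<dots> \<le> (\<Sum>n<n0. p (n + m))" using p0 by (intro sum_mono2) auto
      finally show ?thesis .
    qed
    also have "(\<Sum>n\<le>N. \<Sum>k\<le>n. p k * f (n - k)) \<le> ?P * (1/2)"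
    proof -
      have "(\<Sum>n\<le>N. \<Sum>k\<le>n. p k * f (n - k)) = (\<Sum>k\<le>N. \<Sum>n\<in>{k..N}. p k * f (n - k))"
        using sum.triangle_reindex_eq[of "\<lambda>i j. p i * f j"]
        by (subst (1 2) sum.Sigma) (auto intro!: sum.reindex_bij_witness[of _ "\<lambda>(a,b). (b,a)" "\<lambda>(a,b). (b,a)"])
      also have "\<dots> = (\<Sum>k\<le>N. p k * (\<Sum>n\<in>{k..N}. f (n - k)))" by (simp add: sum_distrib_left)
      also have "\<dots> \<le> (\<Sum>k\<le>N. p k * (1/2))"
      proof (intro sum_mono mult_left_mono p0)
        fix k assume "k \<in> {..N}"
        then have "(\<Sum>n\<in>{k..N}. f (n - k)) = (\<Sum>i\<le>N-k. f i)"
          by (intro sum.reindex_bij_witness[of _ "\<lambda>n. n + k" "\<lambda>n. n - k"]) auto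
        also have "\<dots> \<le> suminf f" using fs f0 by (intro sum_le_suminf) auto
        finally show "(\<Sum>n\<in>{k..N}. f (n - k)) \<le> 1/2" using fh by simp
      qed
      finally show ?thesis by (simp only: sum_distrib_right)
    qed
    finally have "?P \<le> C + (1 - \<delta>) * ?P + \<delta> * (?P * (1/2))" using d by (simp add: C_def)
    then have "\<delta> * ?P \<le> 2 * C" by (simp add: algebra_simps)
    then show ?thesis using d by (simp add: field_simps)
  qed
  show ?thesis
    by (rule bounded_imp_summable[OF p0 bound])
qed

text \<open>
  Strong induction on \<open>n\<close>: if \<open>p \<le> B \<phi>\<close> up to \<open>n - m\<close> and \<open>B\<close> is large compared with the mass of \<open>p\<close>,
  the recursion returns the constant \<open>(1 - \<delta>/4) B\<close>, which leaves room for the passage from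
  \<open>\<phi> (n - m)\<close> to \<open>\<phi> n\<close>.
\<close>

lemma recursive_bound_big_O:
  assumes p0: "\<And>n. 0 \<le> p n" and ps: "summable p" and rec: "recursive_bound p (1/4)"
  shows "\<exists>B\<ge>0. \<forall>n. p n \<le> B * \<phi> n"
proof -
  obtain m \<delta> f where m: "0 < m" and d: "0 < \<delta>" "\<delta> \<le> 1" and f: "dominated f" and fh: "suminf f \<le> 1/4"
    and r: "\<forall>\<^sub>F n in sequentially. p (n + m) \<le> (1 - \<delta>) * p n + \<delta> * (\<Sum>k\<le>n. p k * f (n - k))"
    using rec by (auto simp: recursive_bound_def)
  define S where "S = suminf p"
  have S0: "0 \<le> S" unfolding S_def using ps p0 by (rule suminf_nonneg)
  have "\<forall>\<^sub>F n in sequentially. \<phi> n \<le> (1 + \<delta>/4) * \<phi> (n + m)"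
    using long_tailed_shift d by simp
  then have "\<forall>\<^sub>F n in sequentially. \<phi> n \<le> (1 + \<delta>/4) * \<phi> (n + m) \<and>
      p (n + m) \<le> (1 - \<delta>) * p n + \<delta> * (\<Sum>k\<le>n. p k * f (n - k)) \<and>
      (\<forall>B\<ge>0. (\<forall>k\<le>n. p k \<le> B * \<phi> k) \<longrightarrow>
        (\<Sum>k\<le>n. p k * f (n - k)) \<le> (S + 1/4 + B * (suminf f + 1/4)) * \<phi> n)"
    using r convolution_bound[OF f p0 ps, of "1/4", simplified] unfolding S_def
    by eventually_elim simp
  then obtain N where N: "\<And>n. n \<ge> N \<Longrightarrow> \<phi> n \<le> (1 + \<delta>/4) * \<phi> (n + m) \<and>
      p (n + m) \<le> (1 - \<delta>) * p n + \<delta> * (\<Sum>k\<le>n. p k * f (n - k)) \<and>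
      (\<forall>B\<ge>0. (\<forall>k\<le>n. p k \<le> B * \<phi> k) \<longrightarrow>
        (\<Sum>k\<le>n. p k * f (n - k)) \<le> (S + 1/4 + B * (suminf f + 1/4)) * \<phi> n)"
    by (auto simp: eventually_sequentially)
  \<comment> \<open>The finite sum covers the indices that the recursion does not reach.\<close>
  define B where "B = 4 * (S + 1) + (\<Sum>k<N + m + 1. p k / \<phi> k)"
  have quot0: "0 \<le> p k / \<phi> k" for k using p0 pos[of k] by simp
  have B0: "4 * (S + 1) \<le> B" unfolding B_def using quot0 by (simp add: sum_nonneg)
  have B1: "0 \<le> B" by (rule order_trans[OF _ B0]) (use S0 in simp)
  have "p n \<le> B * \<phi> n" for n
  proof (induction n rule: less_induct)
    case (less n)
    show ?case
    proof (cases "n < N + m + 1")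
      case True
      have "p n / \<phi> n \<le> (\<Sum>k<N + m + 1. p k / \<phi> k)"
        using True quot0 by (intro member_le_sum) auto
      also have "\<dots> \<le> B" unfolding B_def using S0 by simp
      finally show ?thesis using pos[of n] by (simp add: field_simps)
    next
      case False
      show ?thesis
      proof -
        define l where "l = n - m"
        have l: "n = l + m" "l \<ge> N" "l < n" using False m by (auto simp: l_def)
        have IH: "\<forall>k\<le>l. p k \<le> B * \<phi> k" using less l by auto
        have "p n \<le> (1 - \<delta>) * p l + \<delta> * (\<Sum>k\<le>l. p k * f (l - k))" using N[OF l(2)] l(1) by auto
        also have "\<dots> \<le> (1 - \<delta>) * (B * \<phi> l) + \<delta> * ((S + 1/4 + B * (suminf f + 1/4)) * \<phi> l)"
          using N[OF l(2)] IH d B1 by (intro add_mono mult_left_mono) auto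
        also have "\<dots> = ((1 - \<delta>) * B + \<delta> * (S + 1/4 + B * (suminf f + 1/4))) * \<phi> l"
          by (simp add: algebra_simps)
        also have "\<dots> \<le> ((1 - \<delta>/4) * B) * \<phi> l"
        proof (intro mult_right_mono)
          have "B * (suminf f + 1/4) \<le> B * (1/2)" using B1 fh by (intro mult_left_mono) auto
          then have "S + 1/4 + B * (suminf f + 1/4) \<le> 3/4 * B" using B0 by simp
          then have "\<delta> * (S + 1/4 + B * (suminf f + 1/4)) \<le> \<delta> * (3/4 * B)"
            using d by (intro mult_left_mono) auto
          then show "(1 - \<delta>) * B + \<delta> * (S + 1/4 + B * (suminf f + 1/4)) \<le> (1 - \<delta>/4) * B"
            by (simp add: algebra_simps)
        qed (use pos[of l] in simp)
        also have "\<dots> \<le> ((1 - \<delta>/4) * B) * ((1 + \<delta>/4) * \<phi> n)"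
          using N[OF l(2)] l(1) B1 d by (intro mult_left_mono) auto
        also have "\<dots> = B * \<phi> n - (\<delta>/4)^2 * (B * \<phi> n)" by (simp add: algebra_simps power2_eq_square)
        also have "\<dots> \<le> B * \<phi> n" using B1 pos[of n] by simp
        finally show ?thesis .
      qed
    qed
  qed
  with B1 show ?thesis by blast
qed

text \<open>
  Let \<open>L\<close> be the upper limit of \<open>p n / \<phi> n\<close>.  With \<open>p \<le> B \<phi>\<close> known and \<open>\<epsilon>\<close> small compared with \<open>1 / B\<close>,
  the recursion gives \<open>L \<le> (1 - \<delta>) L + \<delta> (suminf p + \<eta>/2)\<close>, so that \<open>\<delta>\<close> cancels.
\<close>

lemma recursive_bound_limsup:
  assumes p0: "\<And>n. 0 \<le> p n" and rec: "\<And>\<epsilon>. 0 < \<epsilon> \<Longrightarrow> recursive_bound p \<epsilon>" and \<eta>: "0 < \<eta>"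
  shows "\<forall>\<^sub>F n in sequentially. p n \<le> (suminf p + \<eta>) * \<phi> n"
proof -
  have ps: "summable p" using recursive_bound_summable p0 rec by simp
  obtain B where B0: "0 \<le> B" and B: "\<And>n. p n \<le> B * \<phi> n"
    using recursive_bound_big_O[OF p0 ps] rec by auto
  define S where "S = suminf p"
  define \<epsilon> where "\<epsilon> = \<eta> / (4 * (B + 1))"
  have \<epsilon>: "0 < \<epsilon>" "\<epsilon> + B * (\<epsilon> + \<epsilon>) \<le> \<eta>/2"
  proof -
    show "0 < \<epsilon>" using \<eta> B0 by (simp add: \<epsilon>_def)
    have "\<epsilon> * (4 * (B + 1)) = \<eta>" using B0 by (simp add: \<epsilon>_def)
    then show "\<epsilon> + B * (\<epsilon> + \<epsilon>) \<le> \<eta>/2" using \<open>0 < \<epsilon>\<close> by (simp add: algebra_simps)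
  qed
  obtain m \<delta> f where d: "0 < \<delta>" "\<delta> \<le> 1" and f: "dominated f" and fh: "suminf f \<le> \<epsilon>"
    and r: "\<forall>\<^sub>F n in sequentially. p (n + m) \<le> (1 - \<delta>) * p n + \<delta> * (\<Sum>k\<le>n. p k * f (n - k))"
    using rec[OF \<epsilon>(1)] by (auto simp: recursive_bound_def)
  have step: "\<forall>\<^sub>F n in sequentially. p (n + m) \<le> (1 - \<delta>) * p n + \<delta> * ((S + \<eta>/2) * \<phi> n)"
    using r convolution_bound[OF f p0 ps \<epsilon>(1)]
  proof eventually_elim
    case (elim n)
    have "(\<Sum>k\<le>n. p k * f (n - k)) \<le> (S + \<epsilon> + B * (suminf f + \<epsilon>)) * \<phi> n"
      using elim(2) B B0 by (auto simp: S_def)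
    also have "\<dots> \<le> (S + \<epsilon> + B * (\<epsilon> + \<epsilon>)) * \<phi> n"
      using B0 fh pos[of n] by (intro mult_right_mono add_left_mono mult_left_mono) auto
    also have "\<dots> \<le> (S + \<eta>/2) * \<phi> n"
      using \<epsilon>(2) pos[of n] by (intro mult_right_mono) auto
    finally have "\<delta> * (\<Sum>k\<le>n. p k * f (n - k)) \<le> \<delta> * ((S + \<eta>/2) * \<phi> n)"
      using d by (intro mult_left_mono) auto
    with elim(1) show ?case by linarith
  qed
  \<comment> \<open>The upper limit \<open>L\<close> is the infimum of the constants that eventually work.\<close>
  define D where "D = {b. \<forall>\<^sub>F n in sequentially. p n \<le> b * \<phi> n}"
  have D0: "0 \<le> b" if "b \<in> D" for b
  proof -
    have "\<forall>\<^sub>F n in sequentially. p n \<le> b * \<phi> n" using that by (simp add: D_def)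
    then obtain n where "p n \<le> b * \<phi> n" by (auto simp: eventually_sequentially)
    then have "0 \<le> b * \<phi> n" using p0[of n] by linarith
    then show ?thesis using pos[of n] by (simp add: zero_le_mult_iff)
  qed
  have bdd: "bdd_below D" by (rule bdd_belowI[of _ 0]) (rule D0)
  have ne: "D \<noteq> {}" using B by (auto simp: D_def intro!: exI[of _ B])
  define L where "L = Inf D"
  have L0: "0 \<le> L" unfolding L_def using ne D0 by (rule cInf_greatest)
  have "L < S + \<eta>"
  proof (rule ccontr)
    assume "\<not> L < S + \<eta>"
    then have LS: "S + \<eta> \<le> L" by simp
    \<comment> \<open>So small that one step of the recursion turns a constant below \<open>L + c\<close> into one below \<open>L\<close>.\<close>
    define c where "c = min 1 (\<delta> * \<eta> / (4 * (L + 2)))"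
    have c: "0 < c" "c \<le> 1" "c * (L + 2) < \<delta> * (\<eta>/2)"
    proof -
      show "0 < c" "c \<le> 1" using d \<eta> L0 by (auto simp: c_def)
      have "c \<le> \<delta> * \<eta> / (4 * (L + 2))" by (simp add: c_def)
      then have "c * (L + 2) \<le> \<delta> * \<eta> / 4" using L0 by (simp add: field_simps)
      also have "\<dots> < \<delta> * (\<eta>/2)" using d \<eta> by simp
      finally show "c * (L + 2) < \<delta> * (\<eta>/2)" .
    qed
    obtain b where b: "b \<in> D" "b < L + c"
      using cInf_lessD[OF ne, of "L + c"] c(1) by (auto simp: L_def)
    define b' where "b' = ((1 - \<delta>) * b + \<delta> * (S + \<eta>/2)) * (1 + c)"
    have S0: "0 \<le> S" unfolding S_def using ps p0 by (rule suminf_nonneg)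
    have lt: "\<forall>\<^sub>F n in sequentially. \<phi> n \<le> (1 + c) * \<phi> (n + m)"
      using long_tailed_shift c(1) by simp
    have "\<forall>\<^sub>F n in sequentially. p n \<le> b * \<phi> n" using b by (simp add: D_def)
    then have "\<forall>\<^sub>F n in sequentially. p (n + m) \<le> b' * \<phi> (n + m)"
      using lt step
    proof eventually_elim
      case (elim n)
      have "p (n + m) \<le> (1 - \<delta>) * (b * \<phi> n) + \<delta> * ((S + \<eta>/2) * \<phi> n)"
        using elim(1,3) d mult_left_mono[OF elim(1), of "1 - \<delta>"] by linarith
      also have "\<dots> = ((1 - \<delta>) * b + \<delta> * (S + \<eta>/2)) * \<phi> n" by (simp add: algebra_simps)
      also have "\<dots> \<le> ((1 - \<delta>) * b + \<delta> * (S + \<eta>/2)) * ((1 + c) * \<phi> (n + m))"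
        using d S0 \<eta> D0[OF b(1)] elim(2) by (intro mult_left_mono) auto
      finally show ?case by (simp add: b'_def mult_ac)
    qed
    then have "b' \<in> D" by (subst (asm) eventually_sequentially_seg) (simp add: D_def)
    then have "L \<le> b'" unfolding L_def using bdd by (rule cInf_lower)
    also have "b' \<le> (L + c - \<delta> * (\<eta>/2)) * (1 + c)"
    proof -
      have "(1 - \<delta>) * b \<le> (1 - \<delta>) * (L + c)" using b(2) d by (intro mult_left_mono) auto
      moreover have "\<delta> * (S + \<eta>/2) \<le> \<delta> * (L - \<eta>/2)" using LS d by (intro mult_left_mono) auto
      moreover have "0 \<le> \<delta> * c" using d c by simp
      ultimately have "(1 - \<delta>) * b + \<delta> * (S + \<eta>/2) \<le> L + c - \<delta> * (\<eta>/2)"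
        by (simp add: algebra_simps)
      then show ?thesis unfolding b'_def using c by (intro mult_right_mono) auto
    qed
    also have "\<dots> \<le> L + c * (L + 2) - \<delta> * (\<eta>/2)"
    proof -
      have "c * c \<le> c" using c by (simp add: mult_left_le)
      moreover have "0 \<le> c * D'" if "0 \<le> D'" for D' using c that by simp
      ultimately have "(L + c - D') * (1 + c) \<le> L + c * (L + 2) - D'" if "0 \<le> D'" for D'
        using that[THEN \<open>\<And>D'. 0 \<le> D' \<Longrightarrow> 0 \<le> c * D'\<close>] by (simp add: algebra_simps)
      then show ?thesis using d \<eta> by simp
    qed
    finally show False using c(3) by linarith
  qed
  then obtain b where b: "b \<in> D" "b < S + \<eta>" using cInf_lessD[OF ne] by (auto simp: L_def)
  have "\<forall>\<^sub>F n in sequentially. p n \<le> b * \<phi> n" using b by (simp add: D_def)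
  then show ?thesis
  proof eventually_elim
    case (elim n)
    also have "b * \<phi> n \<le> (S + \<eta>) * \<phi> n" using b pos[of n] by (intro mult_right_mono) auto
    finally show ?case by (simp add: S_def)
  qed
qed

end

section \<open>Tails of strong subexponential distributions\<close>

text \<open>
  Applying the hypothesis repeatedly moves the argument by any multiple of the logarithm; each
  application gains at least half of \<open>ln y\<close>, because \<open>ln (y - O(ln y))\<close> is eventually above \<open>ln y / 2\<close>.
\<close>

lemma tail_log_shift_iter:
  fixes G :: "real \<Rightarrow> real"
  assumes anti: "antimono G" and pos: "\<And>y. 0 < G y"
    and ins: "\<And>\<eta>. 0 < \<eta> \<Longrightarrow> \<forall>\<^sub>F y in at_top. G (y - ln y) \<le> (1 + \<eta>) * G y"
    and "0 < \<eta>"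
  shows "\<forall>\<^sub>F y in at_top. G (y - real N / 2 * ln y) \<le> (1 + \<eta>) * G y"
  using \<open>0 < \<eta>\<close>
proof (induction N arbitrary: \<eta>)
  case 0
  have "G y \<le> (1 + \<eta>) * G y" for y
    using 0 pos[of y] by (simp add: algebra_simps)
  then show ?case by simp
next
  case (Suc N)
  define e where "e = min 1 (\<eta>/3)"
  have e: "0 < e" "e \<le> 1" "3 * e \<le> \<eta>" using Suc.prems by (auto simp: e_def)
  have ev1: "\<forall>\<^sub>F y in at_top. G (y - real N / 2 * ln y) \<le> (1 + e) * G y"
    by (rule Suc.IH) (rule e)
  have lim: "filterlim (\<lambda>y::real. y - real N / 2 * ln y) at_top at_top" by real_asymp
  have ev2: "\<forall>\<^sub>F y in at_top. G ((y - real N / 2 * ln y) - ln (y - real N / 2 * ln y))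
      \<le> (1 + e) * G (y - real N / 2 * ln y)"
    using eventually_compose_filterlim[OF ins[OF e(1)] lim] .
  have ev3: "\<forall>\<^sub>F y in at_top. ln y / 2 \<le> ln (y - real N / 2 * ln y)" by real_asymp
  show ?case using ev1 ev2 ev3
  proof eventually_elim
    case (elim y)
    have "(y - real N / 2 * ln y) - ln (y - real N / 2 * ln y) \<le> y - real (Suc N) / 2 * ln y"
      using elim(3) by (simp add: field_simps)
    then have "G (y - real (Suc N) / 2 * ln y)
        \<le> G ((y - real N / 2 * ln y) - ln (y - real N / 2 * ln y))"
      using anti by (rule antimonoD[rotated])
    also have "\<dots> \<le> (1 + e) * ((1 + e) * G y)"
      using elim(1,2) e mult_left_mono[OF elim(1), of "1 + e"] by linarith
    also have "\<dots> \<le> (1 + \<eta>) * G y"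
    proof -
      have "e * e \<le> e" using e by (simp add: mult_left_le)
      moreover have "(1 + e) * (1 + e) = 1 + 2 * e + e * e" by (simp add: algebra_simps)
      ultimately have "(1 + e) * (1 + e) \<le> 1 + \<eta>" using e by linarith
      then show ?thesis using pos[of y] by (simp add: mult.assoc[symmetric] mult_right_mono)
    qed
    finally show ?case .
  qed
qed

lemma tail_log_shift:
  fixes G :: "real \<Rightarrow> real"
  assumes anti: "antimono G" and pos: "\<And>y. 0 < G y"
    and ins: "\<And>\<eta>. 0 < \<eta> \<Longrightarrow> \<forall>\<^sub>F y in at_top. G (y - ln y) \<le> (1 + \<eta>) * G y"
    and "0 < \<eta>"
  shows "\<forall>\<^sub>F y in at_top. G (y - C * ln y - c) \<le> (1 + \<eta>) * G y"
proof -
  obtain N :: nat where N: "2 * C + 2 \<le> real N" using real_arch_simple by blast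
  have "\<forall>\<^sub>F y in at_top. c \<le> ln y" by real_asymp
  moreover have "\<forall>\<^sub>F y in at_top. G (y - real N / 2 * ln y) \<le> (1 + \<eta>) * G y"
    by (rule tail_log_shift_iter) (simp_all add: assms)
  ultimately show ?thesis
    using eventually_ge_at_top[of 1]
  proof eventually_elim
    case (elim y)
    have "(C + 1) * ln y \<le> real N / 2 * ln y" using N elim(3) by (intro mult_right_mono) auto
    then have "y - real N / 2 * ln y \<le> y - C * ln y - c" using elim(1) by (simp add: algebra_simps)
    then have "G (y - C * ln y - c) \<le> G (y - real N / 2 * ln y)" using anti by (rule antimonoD[rotated])
    with elim(2) show ?case by simp
  qed
qed

lemma distribution_function_antimono_tail:
  assumes "distribution_function F"
  shows "antimono (tail F)"
proof -
  obtain \<mu> where "real_distribution \<mu>" "F = cdf \<mu>" using assms by (auto simp: distribution_function_def)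
  then interpret real_distribution \<mu> by simp
  show ?thesis using \<open>F = cdf \<mu>\<close> by (auto simp: tail_def antimono_def cdf_nondecreasing)
qed

lemma sum_le_set_integral:
  fixes h :: "real \<Rightarrow> real" and c :: "nat \<Rightarrow> real"
  assumes int: "set_integrable lborel S h" and S: "S \<in> sets lborel" and h0: "\<And>y. 0 \<le> h y"
    and K: "finite K" "\<And>k. k \<in> K \<Longrightarrow> {real k - 1..<real k} \<subseteq> S"
    and c: "\<And>k y. k \<in> K \<Longrightarrow> real k - 1 \<le> y \<Longrightarrow> y < real k \<Longrightarrow> c k \<le> h y"
  shows "sum c K \<le> (LINT y:S|lborel. h y)"
proof -
  have i: "set_integrable lborel {real k - 1..<real k} h" if "k \<in> K" for k
    using int by (rule set_integrable_subset) (use K that in auto)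
  have "sum c K \<le> (\<Sum>k\<in>K. LINT y:{real k - 1..<real k}|lborel. h y)"
  proof (rule sum_mono)
    fix k assume k: "k \<in> K"
    have "c k = (LINT y:{real k - 1..<real k}|lborel. c k)"
      by (simp add: set_lebesgue_integral_def)
    also have "\<dots> \<le> (LINT y:{real k - 1..<real k}|lborel. h y)"
      by (rule set_integral_mono) (use k i c in \<open>auto simp: set_integrable_def\<close>)
    finally show "c k \<le> (LINT y:{real k - 1..<real k}|lborel. h y)" .
  qed
  also have "\<dots> = (LINT y:(\<Union>k\<in>K. {real k - 1..<real k})|lborel. h y)"
    by (rule set_integral_finite_Union[symmetric])
       (use K i in \<open>auto simp: disjoint_family_on_def\<close>)
  also have "\<dots> \<le> (LINT y:S|lborel. h y)"
    unfolding set_lebesgue_integral_def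
  proof (rule integral_mono)
    show "integrable lborel (\<lambda>y. indicator (\<Union>k\<in>K. {real k - 1..<real k}) y *\<^sub>R h y)"
      using set_integrable_subset[OF int, of "\<Union>k\<in>K. {real k - 1..<real k}"] K
      by (auto simp: set_integrable_def)
    show "integrable lborel (\<lambda>y. indicator S y *\<^sub>R h y)" using int by (simp add: set_integrable_def)
    show "indicator (\<Union>k\<in>K. {real k - 1..<real k}) y *\<^sub>R h y \<le> indicator S y *\<^sub>R h y" for y
    proof -
      have "(\<Union>k\<in>K. {real k - 1..<real k}) \<subseteq> S" using K(2) by (rule UN_least)
      then show ?thesis using h0[of y] by (simp add: indicator_def subset_iff del: UN_iff)
    qed
  qed
  finally show ?thesis .
qed

lemma summable_tail:
  assumes "F \<in> strong_subexponential"
  shows "summable (\<lambda>n. tail F (real n))"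
proof -
  let ?G = "tail F"
  have anti: "antimono ?G" and int: "set_integrable lborel {0..} ?G" and pos: "\<And>x. 0 < ?G x"
    using assms distribution_function_antimono_tail by (auto simp: strong_subexponential_def)
  have "(\<Sum>n\<le>N. ?G (real n)) \<le> ?G 0 + (LINT y:{0..}|lborel. ?G y)" for N
  proof -
    have "(\<Sum>n\<in>{1..N}. ?G (real n)) \<le> (LINT y:{0..}|lborel. ?G y)"
      using int pos by (intro sum_le_set_integral) (auto simp: less_imp_le intro: antimonoD[OF anti])
    moreover have "{..N} = insert 0 {1..N}" by auto
    ultimately show ?thesis by simp
  qed
  then show ?thesis using pos by (intro bounded_imp_summable) (auto simp: less_imp_le)
qed

text \<open>
  On \<open>[0, x]\<close> the first factor is at most \<open>tail F 0\<close>.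
\<close>

lemma set_integrable_tail_convolution:
  assumes F: "F \<in> strong_subexponential" and S: "S \<subseteq> {0..x}" "S \<in> sets lborel"
  shows "set_integrable lborel S (\<lambda>y. tail F (x - y) * tail F y)"
proof -
  let ?G = "tail F"
  have anti: "antimono ?G" and int: "set_integrable lborel {0..} ?G" and pos: "\<And>x. 0 < ?G x"
    using F distribution_function_antimono_tail by (auto simp: strong_subexponential_def)
  have [measurable]: "?G \<in> borel_measurable borel"
    using borel_measurable_mono[of "\<lambda>x. - ?G x"] anti
    by (auto simp: antimono_def mono_def)
  have "set_integrable lborel S ?G"
    using int by (rule set_integrable_subset) (use S in auto)
  then have "set_integrable lborel S (\<lambda>y. ?G 0 * ?G y)"
    by (rule set_integrable_mult_right)
  then show ?thesis
  proof (rule set_integrable_bound)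
    show "set_borel_measurable lborel S (\<lambda>y. ?G (x - y) * ?G y)"
      using S unfolding set_borel_measurable_def by measurable
    show "AE y in lborel. y \<in> S \<longrightarrow> norm (?G (x - y) * ?G y) \<le> norm (?G 0 * ?G y)"
    proof (intro AE_I2 impI)
      fix y assume "y \<in> S"
      then have "?G (x - y) \<le> ?G 0" using S by (intro antimonoD[OF anti]) auto
      then show "norm (?G (x - y) * ?G y) \<le> norm (?G 0 * ?G y)"
        using pos[of y] pos[of "x - y"] pos[of 0] by (simp add: abs_mult)
    qed
  qed
qed

text \<open>
  Each of the two ends \<open>[0, J]\<close> and \<open>[x - J, x]\<close> contributes at least \<open>tail F x\<close> times the integral of the
  tail over \<open>[0, J]\<close>.  For large \<open>J\<close> this nearly exhausts the limit \<open>2 \<mu>\<close> of the whole convolution, so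
  almost nothing is left for the middle.
\<close>

lemma strong_subexponential_middle:
  assumes F: "F \<in> strong_subexponential" and \<epsilon>: "0 < \<epsilon>"
  shows "\<exists>J\<ge>0. \<forall>\<^sub>F x in at_top. (LINT y:{J<..<x-J}|lborel. tail F (x - y) * tail F y) \<le> \<epsilon> * tail F x"
proof -
  let ?G = "tail F"
  define \<mu> where "\<mu> = (LINT y:{0..}|lborel. ?G y)"
  have anti: "antimono ?G" and int: "set_integrable lborel {0..} ?G" and pos: "\<And>x. 0 < ?G x"
    and lim: "((\<lambda>x. (LINT y:{0..x}|lborel. ?G (x - y) * ?G y) / ?G x) \<longlongrightarrow> 2 * \<mu>) at_top"
    using F distribution_function_antimono_tail by (auto simp: strong_subexponential_def \<mu>_def)
  have "((\<lambda>J. LINT y:{0..J}|lborel. ?G y) \<longlongrightarrow> \<mu>) at_top"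
    unfolding \<mu>_def using int by (intro tendsto_set_lebesgue_integral_at_top) auto
  then have "\<forall>\<^sub>F J in at_top. \<mu> - \<epsilon>/4 < (LINT y:{0..J}|lborel. ?G y)"
    using \<epsilon> by (intro order_tendstoD) auto
  then have "\<forall>\<^sub>F J in at_top. 0 \<le> J \<and> \<mu> - \<epsilon>/4 < (LINT y:{0..J}|lborel. ?G y)"
    using eventually_ge_at_top[of "0::real"] by eventually_elim simp
  then obtain J where J: "0 \<le> J" "\<mu> - \<epsilon>/4 < (LINT y:{0..J}|lborel. ?G y)"
    by (auto simp: eventually_at_top_linorder)
  have "\<forall>\<^sub>F x in at_top. (LINT y:{0..x}|lborel. ?G (x - y) * ?G y) / ?G x < 2 * \<mu> + \<epsilon>/2"
    using lim \<epsilon> by (intro order_tendstoD) auto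
  then have "\<forall>\<^sub>F x in at_top. (LINT y:{J<..<x-J}|lborel. ?G (x - y) * ?G y) \<le> \<epsilon> * ?G x"
    using eventually_gt_at_top[of "2 * J"]
  proof eventually_elim
    case (elim x)
    let ?h = "\<lambda>y. ?G (x - y) * ?G y"
    have i: "set_integrable lborel S ?h" if "S \<subseteq> {0..x}" "S \<in> sets lborel" for S
      using set_integrable_tail_convolution[OF F that] .
    have "(LINT y:{0..x}|lborel. ?h y) = (LINT y:{0..J} \<union> {J<..<x-J} \<union> {x-J..x}|lborel. ?h y)"
      using J(1) elim(2) by (intro arg_cong[where f="\<lambda>S. set_lebesgue_integral lborel S ?h"]) auto
    also have "\<dots> = (LINT y:{0..J} \<union> {J<..<x-J}|lborel. ?h y) + (LINT y:{x-J..x}|lborel. ?h y)"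
      by (rule set_integral_Un) (use J(1) elim(2) in \<open>auto intro!: i\<close>)
    also have "(LINT y:{0..J} \<union> {J<..<x-J}|lborel. ?h y)
        = (LINT y:{0..J}|lborel. ?h y) + (LINT y:{J<..<x-J}|lborel. ?h y)"
      by (rule set_integral_Un) (use J(1) elim(2) in \<open>auto intro!: i\<close>)
    also have "(LINT y:{x-J..x}|lborel. ?h y) = (LINT y:{0..J}|lborel. ?h y)"
    proof -
      have "(LINT y:{x-J..x}|lborel. ?h y)
          = (LINT y|lborel. indicator {x-J..x} (x + (-1) * y) *\<^sub>R ?h (x + (-1) * y))"
        unfolding set_lebesgue_integral_def by (subst lborel_integral_real_affine[of "-1" _ x]) auto
      also have "\<dots> = (LINT y:{0..J}|lborel. ?h y)"
        unfolding set_lebesgue_integral_def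
        by (intro Bochner_Integration.integral_cong) (auto split: split_indicator)
      finally show ?thesis .
    qed
    finally have tot: "(LINT y:{0..x}|lborel. ?h y)
        = 2 * (LINT y:{0..J}|lborel. ?h y) + (LINT y:{J<..<x-J}|lborel. ?h y)" by simp
    have "?G x * (\<mu> - \<epsilon>/4) \<le> ?G x * (LINT y:{0..J}|lborel. ?G y)"
      using J(2) pos[of x] by (intro mult_left_mono) auto
    also have "\<dots> = (LINT y:{0..J}|lborel. ?G x * ?G y)" by simp
    also have "\<dots> \<le> (LINT y:{0..J}|lborel. ?h y)"
    proof (rule set_integral_mono)
      have "set_integrable lborel {0..J} ?G" using int by (rule set_integrable_subset) auto
      then show "set_integrable lborel {0..J} (\<lambda>y. ?G x * ?G y)" by (rule set_integrable_mult_right)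
      show "set_integrable lborel {0..J} ?h" using J(1) elim(2) by (intro i) auto
      show "?G x * ?G y \<le> ?h y" if "y \<in> {0..J}" for y
        using that pos[of y] by (intro mult_right_mono antimonoD[OF anti]) auto
    qed
    finally show ?case using elim(1) tot pos[of x] by (simp add: field_simps)
  qed
  with J(1) show ?thesis by blast
qed

text \<open>
  The discrete convolution is compared with the integral one on unit intervals.
\<close>

lemma subexponential_sequence_tail:
  assumes F: "F \<in> strong_subexponential"
    and ins: "\<And>\<eta>. 0 < \<eta> \<Longrightarrow> \<forall>\<^sub>F y in at_top. tail F (y - ln y) \<le> (1 + \<eta>) * tail F y"
  shows "subexponential_sequence (\<lambda>n. tail F (real n))"
proof
  let ?G = "tail F"
  have anti: "antimono ?G" and pos: "\<And>x. 0 < ?G x"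
    using F distribution_function_antimono_tail by (auto simp: strong_subexponential_def)
  show "0 < ?G (real n)" for n by (rule pos)
  have lt: "\<forall>\<^sub>F n in sequentially. ?G (real n - c) \<le> (1 + \<eta>) * ?G (real n)" if "0 < \<eta>" for \<eta> c
  proof -
    have "\<forall>\<^sub>F y in at_top. ?G (y - 0 * ln y - c) \<le> (1 + \<eta>) * ?G y"
      by (rule tail_log_shift) (simp_all add: anti pos ins that)
    from eventually_compose_filterlim[OF this filterlim_real_sequentially] show ?thesis by simp
  qed
  show "\<forall>\<^sub>F n in sequentially. ?G (real (n - i)) \<le> (1 + \<eta>) * ?G (real n)" if "0 < \<eta>" for \<eta> i
    using lt[OF that, of "real i"] eventually_ge_at_top[of i]
    by eventually_elim (simp add: of_nat_diff)
  show "\<exists>J. \<forall>\<^sub>F n in sequentially. (\<Sum>k = J..n - J. ?G (real k) * ?G (real (n - k))) \<le> \<epsilon> * ?G (real n)"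
    if \<epsilon>: "0 < \<epsilon>" for \<epsilon>
  proof -
    obtain J' where J': "0 \<le> J'" "\<forall>\<^sub>F x in at_top. (LINT y:{J'<..<x-J'}|lborel. ?G (x - y) * ?G y) \<le> \<epsilon>/2 * ?G x"
      using strong_subexponential_middle[OF F, of "\<epsilon>/2"] \<epsilon> by auto
    define J where "J = nat \<lceil>J'\<rceil> + 2"
    have "\<forall>\<^sub>F n in sequentially. (LINT y:{J'<..<real n - 1 - J'}|lborel. ?G (real n - 1 - y) * ?G y) \<le> \<epsilon>/2 * ?G (real n - 1)"
      by (rule eventually_compose_filterlim[OF J'(2)]) real_asymp
    then have "\<forall>\<^sub>F n in sequentially. (\<Sum>k = J..n - J. ?G (real k) * ?G (real (n - k))) \<le> \<epsilon> * ?G (real n)"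
      using lt[of 1 1, simplified] eventually_ge_at_top[of "2*J"]
    proof eventually_elim
      case (elim n)
      let ?h = "\<lambda>y. ?G (real n - 1 - y) * ?G y"
      \<comment> \<open>For \<open>k - 1 \<le> y < k\<close> monotonicity bounds both factors only after lowering the total \<open>n\<close> to \<open>n - 1\<close>.\<close>
      have "(\<Sum>k = J..n - J. ?G (real k) * ?G (real (n - k))) \<le> (LINT y:{J'<..<real n - 1 - J'}|lborel. ?h y)"
      proof (rule sum_le_set_integral)
        have JJ: "J' + 1 < real J" using J'(1) unfolding J_def by linarith
        show "set_integrable lborel {J'<..<real n - 1 - J'} ?h"
          using J'(1) by (intro set_integrable_tail_convolution[OF F]) auto
        show "{real k - 1..<real k} \<subseteq> {J'<..<real n - 1 - J'}" if "k \<in> {J..n - J}" for k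
          using that JJ elim(3) by auto
        show "?G (real k) * ?G (real (n - k)) \<le> ?h y"
          if "k \<in> {J..n - J}" "real k - 1 \<le> y" "y < real k" for k y
        proof -
          have "?G (real k) \<le> ?G y" using that by (intro antimonoD[OF anti]) auto
          moreover have "?G (real (n - k)) \<le> ?G (real n - 1 - y)"
            using that by (intro antimonoD[OF anti]) (auto simp: of_nat_diff)
          ultimately show ?thesis
            using pos by (subst mult.commute) (intro mult_mono; simp add: less_imp_le)
        qed
      qed (use pos in \<open>auto simp: less_imp_le\<close>)
      also have "\<dots> \<le> \<epsilon>/2 * (2 * ?G (real n))"
        using elim(1,2) \<epsilon> mult_left_mono[OF elim(2), of "\<epsilon>/2"] by linarith
      finally show ?case by simp
    qed
    then show ?thesis by blast
  qed
qed

section \<open>Paths of the autoregressive recursion\<close>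

lemma ar_chain_cong:
  assumes "\<And>k. 1 \<le> k \<Longrightarrow> k \<le> n \<Longrightarrow> \<xi> k \<omega> = \<zeta> k \<omega>'"
  shows "ar_chain a \<xi> x n \<omega> = ar_chain a \<zeta> x n \<omega>'"
  using assms by (induction n) auto

lemma ar_chain_explicit:
  "ar_chain a \<xi> x n \<omega> = a ^ n * x + (\<Sum>k<n. a ^ (n - Suc k) * \<xi> (Suc k) \<omega>)"
proof (induction n)
  case (Suc n)
  have "a * (\<Sum>k<n. a ^ (n - Suc k) * \<xi> (Suc k) \<omega>) = (\<Sum>k<n. a ^ (n - k) * \<xi> (Suc k) \<omega>)"
    unfolding sum_distrib_left
  proof (intro sum.cong refl)
    fix k assume "k \<in> {..<n}"
    then have "n - k = Suc (n - Suc k)" by auto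
    then show "a * (a ^ (n - Suc k) * \<xi> (Suc k) \<omega>) = a ^ (n - k) * \<xi> (Suc k) \<omega>" by simp
  qed
  then show ?case using Suc.IH by (simp add: algebra_simps)
qed simp

lemma ar_chain_decay_lower:
  assumes "0 \<le> a" "\<And>k. 1 \<le> k \<Longrightarrow> 0 \<le> \<xi> k \<omega>"
  shows "a ^ j * ar_chain a \<xi> x n \<omega> \<le> ar_chain a \<xi> x (n + j) \<omega>"
proof (induction j)
  case (Suc j)
  from mult_left_mono[OF Suc.IH assms(1)] assms(2)[of "Suc (n + j)"] show ?case by simp
qed simp

lemma ar_chain_decay_upper:
  assumes a: "0 \<le> a" "a < 1" and s: "0 \<le> s" and small: "\<And>i. n < i \<Longrightarrow> i \<le> n + j \<Longrightarrow> \<xi> i \<omega> \<le> s"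
  shows "ar_chain a \<xi> x (n + j) \<omega> \<le> a ^ j * ar_chain a \<xi> x n \<omega> + s / (1 - a)"
  using small
proof (induction j)
  case 0 then show ?case using a s by simp
next
  case (Suc j)
  have "ar_chain a \<xi> x (n + Suc j) \<omega> \<le> a * (a ^ j * ar_chain a \<xi> x n \<omega> + s / (1 - a)) + s"
    using mult_left_mono[OF Suc.IH a(1)] Suc.prems by (simp add: add_mono)
  also have "\<dots> = a ^ Suc j * ar_chain a \<xi> x n \<omega> + s / (1 - a)" using a by (simp add: field_simps)
  finally show ?case .
qed

lemma sum_inverse_squares_le: "(\<Sum>j<n. 1 / (real j + 1)^2) \<le> 2"
proof -
  have "(\<Sum>j<Suc n. 1 / (real j + 1)^2) \<le> 2 - 1 / (real n + 1)" for n
  proof (induction n)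
    case (Suc n)
    have "1 / (real (Suc n) + 1)^2 \<le> 1 / (real n + 1) - 1 / (real n + 2)"
    proof -
      have "1 / (real n + 1) - 1 / (real n + 2) = 1 / ((real n + 1) * (real n + 2))"
        by (simp add: field_simps)
      moreover have "1 / (real (Suc n) + 1)^2 \<le> 1 / ((real n + 1) * (real n + 2))"
      proof (rule frac_le)
        show "(real n + 1) * (real n + 2) \<le> (real (Suc n) + 1)^2"
          by (simp add: power2_eq_square algebra_simps)
      qed auto
      ultimately show ?thesis by simp
    qed
    then show ?case using Suc by (simp add: add.commute)
  qed simp
  from this[of n] have "(\<Sum>j<Suc n. 1 / (real j + 1)^2) \<le> 2" by (smt (verit) divide_nonneg_nonneg of_nat_0_le_iff)
  then show ?thesis by (simp) (smt (verit) divide_nonneg_nonneg zero_le_power2)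
qed

text \<open>
  A quantitative ``sum large implies summand large'': comparing the weighted innovations with the
  summable weights \<open>1 / (j + 1)\<^sup>2\<close> costs only a polynomial factor, that is a logarithmic shift of the
  variable \<open>log \<xi>\<close>.
\<close>

lemma ar_chain_large_imp_jump:
  assumes a: "0 < a" and big: "R < ar_chain a \<xi> x n \<omega>" and x: "a ^ n * x \<le> R / 2" and R: "0 \<le> R"
  shows "\<exists>k<n. R / 4 / (a ^ (n - Suc k) * (real (n - Suc k) + 1)^2) < \<xi> (Suc k) \<omega>"
proof (rule ccontr)
  assume "\<not> ?thesis"
  then have le: "\<xi> (Suc k) \<omega> \<le> R / 4 / (a ^ (n - Suc k) * (real (n - Suc k) + 1)^2)" if "k < n" for k
    using that by force
  have "(\<Sum>k<n. a ^ (n - Suc k) * \<xi> (Suc k) \<omega>) \<le> (\<Sum>k<n. R / 4 * (1 / (real (n - Suc k) + 1)^2))"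
  proof (rule sum_mono)
    fix k assume "k \<in> {..<n}"
    then have "a ^ (n - Suc k) * \<xi> (Suc k) \<omega>
        \<le> a ^ (n - Suc k) * (R / 4 / (a ^ (n - Suc k) * (real (n - Suc k) + 1)^2))"
      using le a by (intro mult_left_mono) auto
    also have "\<dots> = R / 4 * (1 / (real (n - Suc k) + 1)^2)" using a by simp
    finally show "a ^ (n - Suc k) * \<xi> (Suc k) \<omega> \<le> R / 4 * (1 / (real (n - Suc k) + 1)^2)" .
  qed
  also have "\<dots> = R / 4 * (\<Sum>j<n. 1 / (real j + 1)^2)"
    unfolding sum_distrib_left[symmetric] by (subst sum.nat_diff_reindex) simp
  also have "\<dots> \<le> R / 4 * 2" using R sum_inverse_squares_le by (intro mult_left_mono) auto
  finally show False using big x by (simp add: ar_chain_explicit)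
qed

lemma less_hitting_time_iff: "enat n < hitting_time X x0 \<omega> \<longleftrightarrow> (\<forall>k\<in>{1..n}. x0 < X k \<omega>)"
proof -
  let ?S = "{enat k | k. 1 \<le> k \<and> X k \<omega> \<le> x0}"
  have "hitting_time X x0 \<omega> \<le> enat n \<longleftrightarrow> (\<exists>k\<in>{1..n}. X k \<omega> \<le> x0)"
  proof
    assume le: "hitting_time X x0 \<omega> \<le> enat n"
    then have ne: "?S \<noteq> {}" unfolding hitting_time_def by (cases "?S = {}") (auto simp: Inf_enat_def)
    then have "(LEAST y. y \<in> ?S) \<in> ?S" by (metis (no_types, lifting) LeastI ex_in_conv)
    then have "Inf ?S \<in> ?S" using ne by (simp only: Inf_enat_def if_False)
    then obtain k where "hitting_time X x0 \<omega> = enat k" "1 \<le> k" "X k \<omega> \<le> x0"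
      unfolding hitting_time_def by auto
    then show "\<exists>k\<in>{1..n}. X k \<omega> \<le> x0" using le by auto
  next
    assume "\<exists>k\<in>{1..n}. X k \<omega> \<le> x0"
    then obtain k where k: "1 \<le> k" "k \<le> n" "X k \<omega> \<le> x0" by auto
    then have "Inf ?S \<le> enat k" by (intro Inf_lower) auto
    with k show "hitting_time X x0 \<omega> \<le> enat n"
      unfolding hitting_time_def by (meson enat_ord_simps(1) order_trans)
  qed
  then show ?thesis by (meson linorder_not_le)
qed

section \<open>Survival probabilities\<close>

locale autoregression = prob_space M for M :: "'w measure" +
  fixes \<xi> :: "nat \<Rightarrow> 'w \<Rightarrow> real" and a x0 x :: real
  assumes a: "0 < a" "a < 1" and start: "x0 < x"
    and indep: "indep_vars (\<lambda>_. borel) \<xi> {1..}"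
    and ident: "1 \<le> n \<Longrightarrow> distr M borel (\<xi> n) = distr M borel (\<xi> 1)"
    and innovations_pos: "1 \<le> n \<Longrightarrow> AE \<omega> in M. 0 < \<xi> n \<omega>"
begin

definition survives :: "nat \<Rightarrow> 'w \<Rightarrow> bool" where
  "survives n \<omega> \<longleftrightarrow> (\<forall>k\<in>{1..n}. x0 < ar_chain a \<xi> x k \<omega>)"

definition surv :: "nat \<Rightarrow> real" where
  "surv n = \<P>(\<omega> in M. survives n \<omega>)"

lemma innovation_measurable [measurable]: "\<xi> (Suc n) \<in> borel_measurable M"
  using indep by (auto simp: indep_vars_def)

lemma ar_chain_measurable [measurable]: "ar_chain a \<xi> x n \<in> borel_measurable M"
  by (induction n) simp_all

lemma survives_measurable [measurable]: "Measurable.pred M (survives n)"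
  unfolding survives_def by measurable

lemma prob_innovation:
  assumes "1 \<le> n" "B \<in> sets borel"
  shows "\<P>(\<omega> in M. \<xi> n \<omega> \<in> B) = \<P>(\<omega> in M. \<xi> 1 \<omega> \<in> B)"
proof -
  obtain m where m: "n = Suc m" using assms(1) by (cases n) auto
  have "measure (distr M borel (\<xi> n)) B = measure (distr M borel (\<xi> 1)) B"
    using ident[OF assms(1)] by simp
  then show ?thesis
    using assms innovation_measurable[of m] innovation_measurable[of 0] m
    by (simp add: measure_distr vimage_def Int_def conj_commute)
qed

text \<open>
  Stating the events through the restriction of the innovations to a block of indices admits every
  measurable condition on that block.
\<close>

lemma past_future_independent:
  assumes P: "Measurable.pred (PiM {1..n} (\<lambda>_. borel)) P"
    and Q: "Measurable.pred (PiM {n<..n + m} (\<lambda>_. borel)) Q"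
  shows "\<P>(\<omega> in M. P (\<lambda>i\<in>{1..n}. \<xi> i \<omega>) \<and> Q (\<lambda>i\<in>{n<..n + m}. \<xi> i \<omega>))
    = \<P>(\<omega> in M. P (\<lambda>i\<in>{1..n}. \<xi> i \<omega>)) * \<P>(\<omega> in M. Q (\<lambda>i\<in>{n<..n + m}. \<xi> i \<omega>))"
proof -
  let ?A = "PiM {1..n} (\<lambda>_. borel :: real measure)" and ?B = "PiM {n<..n + m} (\<lambda>_. borel :: real measure)"
  have ind: "indep_var ?A (\<lambda>\<omega>. \<lambda>i\<in>{1..n}. \<xi> i \<omega>) ?B (\<lambda>\<omega>. \<lambda>i\<in>{n<..n + m}. \<xi> i \<omega>)"
    by (rule indep_var_restrict[OF indep]) auto
  have "{w \<in> space ?A. P w} \<in> sets ?A" "{w \<in> space ?B. Q w} \<in> sets ?B" using P Q by auto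
  from indep_varD[OF ind this] show ?thesis
    by (simp add: vimage_def space_PiM Int_def conj_commute)
qed

lemma survives_restrict:
  "survives n \<omega> \<longleftrightarrow> (\<forall>k\<in>{1..n}. x0 < ar_chain a (\<lambda>i w. w i) x k (\<lambda>i\<in>{1..n}. \<xi> i \<omega>))"
proof -
  have "ar_chain a \<xi> x k \<omega> = ar_chain a (\<lambda>i w. w i) x k (\<lambda>i\<in>{1..n}. \<xi> i \<omega>)" if "k \<le> n" for k
    using that by (intro ar_chain_cong) auto
  then show ?thesis by (auto simp: survives_def)
qed

lemma ar_chain_PiM_measurable:
  "k \<le> n \<Longrightarrow> (\<lambda>w. ar_chain a (\<lambda>i w. w i) x k w) \<in> borel_measurable (PiM {1..n} (\<lambda>_. borel))"
proof (induction k)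
  case 0
  have "ar_chain a (\<lambda>i w. w i) x 0 = (\<lambda>_. x)" by auto
  then show ?case by simp
next
  case (Suc k)
  then have [measurable]: "(\<lambda>w. w (Suc k)) \<in> borel_measurable (PiM {1..n} (\<lambda>_. borel))"
    by (intro measurable_component_singleton) auto
  from Suc show ?case by simp
qed

text \<open>
  The chain up to time \<open>n\<close> is a measurable function of the first \<open>n\<close> innovations: it is \<open>ar_chain\<close>
  itself, run on the coordinate functions of the product space.
\<close>

lemma survival_future_independent:
  assumes B: "B \<in> sets borel" and D: "D \<in> sets borel"
    and b: "Measurable.pred (PiM {n<..n + m} (\<lambda>_. borel)) Q"
  shows "\<P>(\<omega> in M. (survives n \<omega> \<and> ar_chain a \<xi> x n \<omega> \<in> B \<and> (\<forall>i\<in>{1..n}. \<xi> i \<omega> \<in> D)) \<and> Q (\<lambda>i\<in>{n<..n + m}. \<xi> i \<omega>))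
    = \<P>(\<omega> in M. survives n \<omega> \<and> ar_chain a \<xi> x n \<omega> \<in> B \<and> (\<forall>i\<in>{1..n}. \<xi> i \<omega> \<in> D)) * \<P>(\<omega> in M. Q (\<lambda>i\<in>{n<..n + m}. \<xi> i \<omega>))"
proof -
  let ?P = "\<lambda>w. (\<forall>k\<in>{1..n}. x0 < ar_chain a (\<lambda>i w. w i) x k w)
    \<and> ar_chain a (\<lambda>i w. w i) x n w \<in> B \<and> (\<forall>i\<in>{1..n}. w i \<in> D)"
  have m1: "Measurable.pred (PiM {1..n} (\<lambda>_. borel)) (\<lambda>w. x0 < ar_chain a (\<lambda>i w. w i) x k w)" if "k \<in> {1..n}" for k
  proof -
    have [measurable]: "(\<lambda>w. ar_chain a (\<lambda>i w. w i) x k w) \<in> borel_measurable (PiM {1..n} (\<lambda>_. borel))"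
      using that by (intro ar_chain_PiM_measurable) auto
    show ?thesis by measurable
  qed
  have m2: "Measurable.pred (PiM {1..n} (\<lambda>_. borel)) (\<lambda>w. ar_chain a (\<lambda>i w. w i) x n w \<in> B)"
    using B ar_chain_PiM_measurable[of n n] by (auto intro!: pred_sets2)
  have m3: "Measurable.pred (PiM {1..n} (\<lambda>_. borel)) (\<lambda>w. w i \<in> D)" if "i \<in> {1..n}" for i
    using D measurable_component_singleton[OF that, of "\<lambda>_. borel"] by (auto intro!: pred_sets2)
  have P: "Measurable.pred (PiM {1..n} (\<lambda>_. borel)) ?P"
    using m1 m2 m3 by (intro pred_intros_logic pred_intros_finite) auto
  have eq: "survives n \<omega> \<and> ar_chain a \<xi> x n \<omega> \<in> B \<and> (\<forall>i\<in>{1..n}. \<xi> i \<omega> \<in> D) \<longleftrightarrow> ?P (\<lambda>i\<in>{1..n}. \<xi> i \<omega>)" for \<omega>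
  proof -
    have "ar_chain a \<xi> x n \<omega> = ar_chain a (\<lambda>i w. w i) x n (\<lambda>i\<in>{1..n}. \<xi> i \<omega>)"
      by (intro ar_chain_cong) auto
    then show ?thesis by (simp add: survives_restrict[of n])
  qed
  show ?thesis unfolding eq by (rule past_future_independent[OF P b])
qed

lemma survival_next_innovation_independent:
  assumes "D \<in> sets borel" "C \<in> sets borel"
  shows "\<P>(\<omega> in M. (survives n \<omega> \<and> (\<forall>i\<in>{1..n}. \<xi> i \<omega> \<in> D)) \<and> \<xi> (Suc n) \<omega> \<in> C)
    = \<P>(\<omega> in M. survives n \<omega> \<and> (\<forall>i\<in>{1..n}. \<xi> i \<omega> \<in> D)) * \<P>(\<omega> in M. \<xi> 1 \<omega> \<in> C)"
proof -
  have "Measurable.pred (PiM {n<..n + 1} (\<lambda>_. borel)) (\<lambda>w. w (Suc n) \<in> C)"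
    using assms measurable_component_singleton[of "Suc n" "{n<..n+1}" "\<lambda>_. borel"] by (auto intro!: pred_sets2)
  from survival_future_independent[where B=UNIV and D=D and n=n and m=1, OF _ assms(1) this]
  show ?thesis by (simp add: prob_innovation[OF _ assms(2), of "Suc n"])
qed

lemma prob_future_not_small:
  assumes "0 < m"
  shows "\<P>(\<omega> in M. \<exists>i\<in>{n<..n + m}. s < \<xi> i \<omega>) = 1 - \<P>(\<omega> in M. \<xi> 1 \<omega> \<le> s) ^ m"
proof -
  have ms: "{\<omega> \<in> space M. \<xi> i \<omega> \<le> s} \<in> events" if "1 \<le> i" for i
    using that by (cases i) simp_all
  have "(\<Inter>i\<in>{n<..n + m}. \<xi> i -` {..s} \<inter> space M) = {\<omega>\<in>space M. \<forall>i\<in>{n<..n + m}. \<xi> i \<omega> \<le> s}"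
    using assms by auto
  moreover have "prob (\<Inter>i\<in>{n<..n + m}. \<xi> i -` {..s} \<inter> space M) = (\<Prod>i\<in>{n<..n + m}. prob (\<xi> i -` {..s} \<inter> space M))"
    by (rule indep_varsD[OF indep]) (use assms in auto)
  moreover have "(\<Prod>i\<in>{n<..n + m}. prob (\<xi> i -` {..s} \<inter> space M)) = (\<Prod>i\<in>{n<..n + m}. \<P>(\<omega> in M. \<xi> 1 \<omega> \<le> s))"
  proof (intro prod.cong refl)
    fix i assume "i \<in> {n<..n + m}"
    then show "prob (\<xi> i -` {..s} \<inter> space M) = \<P>(\<omega> in M. \<xi> 1 \<omega> \<le> s)"
      using prob_innovation[of i "{..s}"] by (simp add: vimage_def Int_def conj_commute)
  qed
  ultimately have all: "\<P>(\<omega> in M. \<forall>i\<in>{n<..n + m}. \<xi> i \<omega> \<le> s) = \<P>(\<omega> in M. \<xi> 1 \<omega> \<le> s) ^ m"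
    by simp
  have "{\<omega>\<in>space M. \<exists>i\<in>{n<..n + m}. s < \<xi> i \<omega>} = space M - {\<omega>\<in>space M. \<forall>i\<in>{n<..n + m}. \<xi> i \<omega> \<le> s}"
    by (auto simp: not_le)
  moreover have "{\<omega>\<in>space M. \<forall>i\<in>{n<..n + m}. \<xi> i \<omega> \<le> s} \<in> events"
    by (rule sets.sets_Collect_finite_All') (use ms assms in auto)
  ultimately show ?thesis using all by (simp add: prob_compl)
qed

lemma surv_0: "surv 0 = 1"
  by (simp add: surv_def survives_def prob_space)

lemma surv_nonneg: "0 \<le> surv n"
  by (simp add: surv_def)

lemma surv_antimono: "m \<le> n \<Longrightarrow> surv n \<le> surv m"
  unfolding surv_def by (intro finite_measure_mono) (auto simp: survives_def)

text \<open>
  The summand with index \<open>k\<close> is a lower bound for the probability that the chain is alive after \<open>k\<close> steps and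
  innovation \<open>k + 1\<close> is the first one above \<open>b\<close>.  After such a jump the chain stays above \<open>x0\<close> up to
  time \<open>n\<close>, because positive innovations only slow down its decay.  Asking for the first large
  innovation makes these events disjoint.
\<close>

lemma surv_lower:
  assumes K: "K \<le> n" and b: "x0 / a ^ n \<le> b" and b0: "0 \<le> b" and x0: "0 \<le> x0"
  defines "q \<equiv> \<P>(\<omega> in M. b < \<xi> 1 \<omega>)"
  shows "(\<Sum>k<K. (surv k - real k * q) * q) \<le> surv n"
proof -
  define E where "E k = {\<omega>\<in>space M. (survives k \<omega> \<and> (\<forall>i\<in>{1..k}. \<xi> i \<omega> \<in> {..b})) \<and> \<xi> (Suc k) \<omega> \<in> {b<..}}" for k
  have meas: "{\<omega>\<in>space M. \<xi> i \<omega> \<in> {..b}} \<in> events" "{\<omega>\<in>space M. \<xi> i \<omega> \<in> {b<..}} \<in> events" if "1 \<le> i" for i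
    using that by (cases i; simp)+
  have all: "{\<omega>\<in>space M. \<forall>i\<in>{1..k}. \<xi> i \<omega> \<in> {..b}} \<in> events" for k
    by (rule sets.sets_Collect_finite_All) (use meas in auto)
  have sall: "{\<omega>\<in>space M. survives k \<omega> \<and> (\<forall>i\<in>{1..k}. \<xi> i \<omega> \<in> {..b})} \<in> events" for k
    by (rule sets.sets_Collect_conj) (use all in auto)
  have Em: "E k \<in> events" for k
    unfolding E_def by (rule sets.sets_Collect_conj, rule meas(2), simp, rule sall)
  have E1: "(surv k - real k * q) * q \<le> prob (E k)" for k
  proof -
    let ?N = "\<Union>i\<in>{1..k}. {\<omega>\<in>space M. \<xi> i \<omega> \<in> {b<..}}"
    have "surv k \<le> prob ({\<omega>\<in>space M. survives k \<omega> \<and> (\<forall>i\<in>{1..k}. \<xi> i \<omega> \<in> {..b})} \<union> ?N)"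
      unfolding surv_def using sall meas
      by (intro finite_measure_mono sets.Un sets.finite_UN) (auto simp: not_le)
    also have "\<dots> \<le> \<P>(\<omega> in M. survives k \<omega> \<and> (\<forall>i\<in>{1..k}. \<xi> i \<omega> \<in> {..b})) + prob ?N"
      using sall meas by (intro measure_Un_le sets.finite_UN) auto
    also have "prob ?N \<le> (\<Sum>i\<in>{1..k}. \<P>(\<omega> in M. \<xi> i \<omega> \<in> {b<..}))"
      using meas by (intro measure_UNION_le) auto
    also have "\<dots> = (\<Sum>i\<in>{1..k}. q)"
      by (intro sum.cong refl) (subst prob_innovation; simp add: q_def)
    finally have "surv k - real k * q \<le> \<P>(\<omega> in M. survives k \<omega> \<and> (\<forall>i\<in>{1..k}. \<xi> i \<omega> \<in> {..b}))" by simp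
    then have "(surv k - real k * q) * q \<le> \<P>(\<omega> in M. survives k \<omega> \<and> (\<forall>i\<in>{1..k}. \<xi> i \<omega> \<in> {..b})) * q"
      by (intro mult_right_mono) (simp_all add: q_def)
    also have "\<dots> = prob (E k)"
      unfolding E_def q_def using survival_next_innovation_independent[of "{..b}" "{b<..}" k] by simp
    finally show ?thesis .
  qed
  have "(\<Sum>k<K. (surv k - real k * q) * q) \<le> (\<Sum>k<K. prob (E k))" by (intro sum_mono E1)
  also have "\<dots> = prob (\<Union>k\<in>{..<K}. E k)"
  proof (rule finite_measure_finite_Union[symmetric])
    show "disjoint_family_on E {..<K}"
      unfolding disjoint_family_on_def
    proof (intro ballI impI)
      have "E k \<inter> E l = {}" if "k < l" for k l
      proof -
        have "\<xi> (Suc k) \<omega> \<le> b" if "\<omega> \<in> E l" for \<omega>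
          using that \<open>k < l\<close> by (simp add: E_def)
        moreover have "b < \<xi> (Suc k) \<omega>" if "\<omega> \<in> E k" for \<omega>
          using that by (simp add: E_def)
        ultimately show ?thesis by fastforce
      qed
      then show "E k \<inter> E l = {}" if "k \<noteq> l" for k l using that by (metis Int_commute nat_neq_iff)
    qed
  qed (use Em in auto)
  also have "\<dots> \<le> surv n"
    unfolding surv_def
  proof (rule finite_measure_mono_AE)
    have "AE \<omega> in M. \<forall>i. 0 < \<xi> (Suc i) \<omega>"
      unfolding AE_all_countable using innovations_pos by simp
    then show "AE \<omega> in M. \<omega> \<in> (\<Union>k\<in>{..<K}. E k) \<longrightarrow> \<omega> \<in> {\<omega>\<in>space M. survives n \<omega>}"
    proof eventually_elim
      case (elim \<omega>)
      have xi0: "0 \<le> \<xi> i \<omega>" if "1 \<le> i" for i using elim[rule_format, of "i - 1"] that by simp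
      show ?case
      proof
        assume "\<omega> \<in> (\<Union>k\<in>{..<K}. E k)"
        then obtain k where k: "k < K" and \<omega>: "\<omega> \<in> space M" and sk: "survives k \<omega>" and jump: "b < \<xi> (Suc k) \<omega>"
          by (auto simp: E_def)
        have "0 \<le> a ^ k * x" using a x0 start by simp
        also have "\<dots> \<le> ar_chain a \<xi> x k \<omega>"
          using ar_chain_decay_lower[of a \<xi> \<omega> k x 0] a xi0 by simp
        finally have "b < ar_chain a \<xi> x (Suc k) \<omega>" using jump a by (simp add: add_strict_increasing2)
        then have high: "a ^ j * b < ar_chain a \<xi> x (Suc k + j) \<omega>" for j
          using ar_chain_decay_lower[of a \<xi> \<omega> j x "Suc k"] a xi0
          by (meson less_le_trans mult_strict_left_mono zero_less_power less_imp_le)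
        have "x0 < ar_chain a \<xi> x i \<omega>" if i: "i \<in> {1..n}" for i
        proof (cases "i \<le> k")
          case True
          then show ?thesis using sk i by (auto simp: survives_def)
        next
          case False
          then obtain j where j: "i = Suc k + j" using le_Suc_ex[of "Suc k" i] by auto
          have "x0 \<le> a ^ n * b" using b a by (simp add: field_simps)
          also have "\<dots> \<le> a ^ j * b"
            using a b0 i j by (intro mult_right_mono power_decreasing) auto
          also have "\<dots> < ar_chain a \<xi> x i \<omega>" using high j by simp
          finally show ?thesis .
        qed
        then show "\<omega> \<in> {\<omega>\<in>space M. survives n \<omega>}" using \<omega> by (simp add: survives_def)
      qed
    qed
  qed simp
  finally show ?thesis .
qed

text \<open>
  A union bound over the time of the jump that keeps the chain above \<open>R\<close>; that jump is independent of
  survival before it.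
\<close>

lemma surv_high_le:
  assumes R: "0 \<le> R" and x: "a ^ n * x \<le> R / 2"
  shows "\<P>(\<omega> in M. survives n \<omega> \<and> R < ar_chain a \<xi> x n \<omega>)
    \<le> (\<Sum>k<n. surv k * \<P>(\<omega> in M. R / 4 / (a ^ (n - Suc k) * (real (n - Suc k) + 1)^2) < \<xi> 1 \<omega>))"
proof -
  define c where "c k = R / 4 / (a ^ (n - Suc k) * (real (n - Suc k) + 1)^2)" for k
  let ?E = "\<lambda>k. {\<omega>\<in>space M. survives k \<omega> \<and> c k < \<xi> (Suc k) \<omega>}"
  have "\<P>(\<omega> in M. survives n \<omega> \<and> R < ar_chain a \<xi> x n \<omega>) \<le> prob (\<Union>k\<in>{..<n}. ?E k)"
  proof (rule finite_measure_mono)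
    show "{\<omega>\<in>space M. survives n \<omega> \<and> R < ar_chain a \<xi> x n \<omega>} \<subseteq> (\<Union>k\<in>{..<n}. ?E k)"
    proof
      fix \<omega> assume \<omega>: "\<omega> \<in> {\<omega>\<in>space M. survives n \<omega> \<and> R < ar_chain a \<xi> x n \<omega>}"
      then obtain k where k: "k < n" "c k < \<xi> (Suc k) \<omega>"
        using ar_chain_large_imp_jump[OF a(1), of R \<xi> x n \<omega>] x R by (auto simp: c_def)
      moreover have "survives k \<omega>" using \<omega> k(1) by (auto simp: survives_def)
      ultimately show "\<omega> \<in> (\<Union>k\<in>{..<n}. ?E k)" using \<omega> by auto
    qed
  qed measurable
  also have "\<dots> \<le> (\<Sum>k<n. prob (?E k))" by (intro measure_UNION_le) auto
  also have "\<dots> = (\<Sum>k<n. surv k * \<P>(\<omega> in M. c k < \<xi> 1 \<omega>))"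
    using survival_next_innovation_independent[of UNIV "{c _<..}"] by (intro sum.cong) (simp_all add: surv_def)
  finally show ?thesis by (simp add: c_def)
qed

text \<open>
  With probability \<open>\<delta>\<close> the next \<open>m\<close> innovations are at most \<open>s\<close>; from a state at most \<open>R\<close> they lead
  to a state at most \<open>x0\<close>.  Thus \<open>surv (n + m) \<le> h + (1 - \<delta>) (surv n - h)\<close>, where \<open>h\<close> is the
  probability to be alive above \<open>R\<close> at time \<open>n\<close>.
\<close>

lemma surv_recursion:
  assumes m: "0 < m" and s: "0 \<le> s" and R: "0 \<le> R" "a ^ m * R + s / (1 - a) \<le> x0" and x: "a ^ n * x \<le> R / 2"
  defines "\<delta> \<equiv> \<P>(\<omega> in M. \<xi> 1 \<omega> \<le> s) ^ m"
  shows "surv (n + m) \<le> (1 - \<delta>) * surv n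
    + \<delta> * (\<Sum>k<n. surv k * \<P>(\<omega> in M. R / 4 / (a ^ (n - Suc k) * (real (n - Suc k) + 1)^2) < \<xi> 1 \<omega>))"
proof -
  let ?H = "{\<omega>\<in>space M. survives n \<omega> \<and> R < ar_chain a \<xi> x n \<omega>}"
  let ?L = "{\<omega>\<in>space M. survives n \<omega> \<and> ar_chain a \<xi> x n \<omega> \<le> R}"
  let ?L' = "{\<omega>\<in>space M. (survives n \<omega> \<and> ar_chain a \<xi> x n \<omega> \<le> R) \<and> (\<exists>i\<in>{n<..n + m}. s < \<xi> i \<omega>)}"
  have ex: "{\<omega>\<in>space M. \<exists>i\<in>{n<..n + m}. s < \<xi> i \<omega>} \<in> events"
  proof (rule sets.sets_Collect_finite_Ex)
    show "{\<omega>\<in>space M. s < \<xi> i \<omega>} \<in> events" if "i \<in> {n<..n + m}" for i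
      using that by (cases i) auto
  qed simp
  have Hm: "?H \<in> events" and Lm: "?L \<in> events" by measurable
  have L': "?L' \<in> events" by (rule sets.sets_Collect_conj[OF ex Lm])
  have "surv (n + m) \<le> prob (?H \<union> ?L')"
    unfolding surv_def
  proof (rule finite_measure_mono)
    show "{\<omega>\<in>space M. survives (n + m) \<omega>} \<subseteq> ?H \<union> ?L'"
    proof
      fix \<omega> assume \<omega>: "\<omega> \<in> {\<omega>\<in>space M. survives (n + m) \<omega>}"
      then have sn: "survives n \<omega>" by (auto simp: survives_def)
      have "\<exists>i\<in>{n<..n + m}. s < \<xi> i \<omega>" if le: "ar_chain a \<xi> x n \<omega> \<le> R"
      proof (rule ccontr)
        assume "\<not> ?thesis"
        then have "\<xi> i \<omega> \<le> s" if "n < i" "i \<le> n + m" for i using that by force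
        then have "ar_chain a \<xi> x (n + m) \<omega> \<le> a ^ m * ar_chain a \<xi> x n \<omega> + s / (1 - a)"
          using a s by (intro ar_chain_decay_upper) auto
        also have "\<dots> \<le> a ^ m * R + s / (1 - a)" using le a by simp
        also have "\<dots> \<le> x0" by (rule R)
        moreover have "x0 < ar_chain a \<xi> x (n + m) \<omega>"
          using \<omega> m unfolding survives_def by (auto dest!: bspec[of _ _ "n + m"])
        ultimately show False by linarith
      qed
      with \<omega> sn show "\<omega> \<in> ?H \<union> ?L'" by (auto simp: not_le)
    qed
    show "?H \<union> ?L' \<in> events" using Hm L' by (rule sets.Un)
  qed
  also have "\<dots> \<le> prob ?H + prob ?L'" using Hm L' by (rule measure_Un_le)
  also have "prob ?L' = prob ?L * (1 - \<delta>)"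
  proof -
    have comp: "Measurable.pred (PiM {n<..n + m} (\<lambda>_. borel)) (\<lambda>w. s < w i)" if "i \<in> {n<..n + m}" for i
      using measurable_component_singleton[OF that, of "\<lambda>_. borel :: real measure"] by simp
    have "Measurable.pred (PiM {n<..n + m} (\<lambda>_. borel)) (\<lambda>w. \<exists>i\<in>{n<..n + m}. s < w i)"
      using comp by (intro pred_intros_finite) auto
    from survival_future_independent[where B="{..R}" and D=UNIV and n=n and m=m, OF _ _ this]
    show ?thesis using prob_future_not_small[OF m, of n s] by (simp add: \<delta>_def)
  qed
  also have "prob ?L = surv n - prob ?H"
  proof -
    have "surv n = prob (?H \<union> ?L)" unfolding surv_def by (intro arg_cong[where f=prob]) auto
    also have "\<dots> = prob ?H + prob ?L" using Hm Lm by (intro finite_measure_Union) auto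
    finally show ?thesis by simp
  qed
  finally have "surv (n + m) \<le> (1 - \<delta>) * surv n + \<delta> * prob ?H" by (simp add: algebra_simps)
  also have "\<dots> \<le> (1 - \<delta>) * surv n + \<delta> * (\<Sum>k<n. surv k * \<P>(\<omega> in M. R / 4 / (a ^ (n - Suc k) * (real (n - Suc k) + 1)^2) < \<xi> 1 \<omega>))"
    using surv_high_le[OF R(1) x] by (intro add_left_mono mult_left_mono) (auto simp: \<delta>_def)
  finally show ?thesis .
qed

lemma hitting_time_measurable:
  "hitting_time (ar_chain a \<xi> x) x0 \<in> measurable M (count_space UNIV)"
proof -
  let ?T = "hitting_time (ar_chain a \<xi> x) x0"
  have lt: "Measurable.pred M (\<lambda>\<omega>. enat n < ?T \<omega>)" for n
  proof -
    have "(\<lambda>\<omega>. enat n < ?T \<omega>) = survives n" by (simp add: fun_eq_iff less_hitting_time_iff survives_def)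
    then show ?thesis by simp
  qed
  have "?T -` {t} \<inter> space M \<in> events" for t
  proof (cases t)
    case (enat n)
    have "?T -` {t} \<inter> space M = {\<omega>\<in>space M. \<not> enat n < ?T \<omega> \<and> (\<forall>k<n. enat k < ?T \<omega>)}"
    proof -
      have "?T \<omega> = enat n \<longleftrightarrow> \<not> enat n < ?T \<omega> \<and> (\<forall>k<n. enat k < ?T \<omega>)" for \<omega>
        by (cases "?T \<omega>") (auto simp: not_less le_less)
      then show ?thesis using enat by auto
    qed
    also have "\<dots> \<in> events" using lt by measurable
    finally show ?thesis .
  next
    case infinity
    have "?T -` {t} \<inter> space M = {\<omega>\<in>space M. \<forall>k. enat k < ?T \<omega>}"
    proof -
      have "?T \<omega> = \<infinity> \<longleftrightarrow> (\<forall>k. enat k < ?T \<omega>)" for \<omega>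
        by (cases "?T \<omega>") auto
      then show ?thesis using infinity by auto
    qed
    also have "\<dots> \<in> events" using lt by measurable
    finally show ?thesis .
  qed
  then show ?thesis by (simp add: measurable_count_space_eq2_countable)
qed

lemma mean_hitting_time:
  "(\<integral>\<^sup>+ \<omega>. ennreal_of_enat (hitting_time (ar_chain a \<xi> x) x0 \<omega>) \<partial>M) = (\<Sum>n. ennreal (surv n))"
  by (simp add: nn_integral_enat_function[OF hitting_time_measurable] less_hitting_time_iff
      survives_def surv_def emeasure_eq_measure)

end

section \<open>Survival asymptotics for heavy-tailed innovations\<close>

context autoregression
begin

text \<open>
  The probability that an innovation made \<open>j\<close> steps ago is large enough to account for a current
  height above \<open>4 r\<close> of the chain.
\<close>

definition jump_tail :: "real \<Rightarrow> nat \<Rightarrow> real" where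
  "jump_tail r j = \<P>(\<omega> in M. r / (a ^ j * (real j + 1)^2) < \<xi> 1 \<omega>)"

lemma jump_tail_nonneg: "0 \<le> jump_tail r j"
  by (simp add: jump_tail_def)

text \<open>
  Since \<open>j + 1 \<le> j + i + 1\<close>, raising the level by the factor \<open>a\<^sup>-\<^sup>i\<close> costs at least as much as \<open>i\<close>
  further steps of decay.  The mass of \<open>jump_tail (1 / a ^ i)\<close> is therefore at most a remainder of a
  convergent series.
\<close>

lemma jump_tail_shift: "jump_tail (1 / a ^ i) j \<le> jump_tail 1 (j + i)"
  unfolding jump_tail_def
proof (rule finite_measure_mono)
  have "1 / (a ^ (j + i) * (real (j + i) + 1)^2) \<le> 1 / (a ^ (j + i) * (real j + 1)^2)"
    using a by (intro divide_left_mono mult_left_mono power_mono mult_pos_pos) auto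
  also have "\<dots> = 1 / a ^ i / (a ^ j * (real j + 1)^2)" by (simp add: power_add)
  finally show "{\<omega>\<in>space M. 1 / a ^ i / (a ^ j * (real j + 1)^2) < \<xi> 1 \<omega>}
      \<subseteq> {\<omega>\<in>space M. 1 / (a ^ (j + i) * (real (j + i) + 1)^2) < \<xi> 1 \<omega>}" by auto
qed simp

text \<open>
  If no innovation is below \<open>(1 - a) x0\<close>, the interval above \<open>x0\<close> is invariant.
\<close>

lemma surv_eq_1_if_never_below:
  assumes "\<P>(\<omega> in M. a * x0 + \<xi> 1 \<omega> < x0) = 0"
  shows "surv n = 1"
proof -
  let ?c = "x0 - a * x0"
  have "AE \<omega> in M. ?c \<le> \<xi> (Suc i) \<omega>" for i
  proof -
    have "\<P>(\<omega> in M. \<xi> (Suc i) \<omega> \<in> {..<?c}) = \<P>(\<omega> in M. \<xi> 1 \<omega> \<in> {..<?c})"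
      by (rule prob_innovation) auto
    also have "\<dots> = \<P>(\<omega> in M. a * x0 + \<xi> 1 \<omega> < x0)" by (intro arg_cong[where f=prob]) auto
    finally have "\<P>(\<omega> in M. \<xi> (Suc i) \<omega> < ?c) = 0" using assms by simp
    then have "AE \<omega> in M. \<not> \<xi> (Suc i) \<omega> < ?c" by (subst (asm) prob_eq_0) auto
    then show ?thesis by (simp add: not_less)
  qed
  then have "AE \<omega> in M. \<forall>i. ?c \<le> \<xi> (Suc i) \<omega>" by (simp add: AE_all_countable)
  then have "AE \<omega> in M. survives n \<omega>"
  proof eventually_elim
    case (elim \<omega>)
    have "x0 < ar_chain a \<xi> x k \<omega>" for k
    proof (induction k)
      case (Suc k)
      have "a * x0 < a * ar_chain a \<xi> x k \<omega>" using Suc a by simp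
      with elim[rule_format, of k] show ?case by simp
    qed (use start in simp)
    then show ?case by (simp add: survives_def)
  qed
  then show ?thesis unfolding surv_def by (subst prob_Collect_eq_1) auto
qed

lemma positive_mass_at_smaller_level:
  assumes "0 < \<P>(\<omega> in M. \<xi> 1 \<omega> < c)" "0 < c"
  obtains s where "0 \<le> s" "s < c" "0 < \<P>(\<omega> in M. \<xi> 1 \<omega> \<le> s)"
proof -
  have "\<exists>n. \<P>(\<omega> in M. \<xi> 1 \<omega> \<le> c - 1 / real (Suc n)) \<noteq> 0"
  proof (rule ccontr)
    assume "\<not> ?thesis"
    then have "\<P>(\<omega> in M. \<xi> 1 \<omega> \<le> c - 1 / real (Suc n)) = 0" for n by blast
    then have "AE \<omega> in M. \<not> \<xi> 1 \<omega> \<le> c - 1 / real (Suc n)" for n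
      by (subst (asm) prob_eq_0) auto
    then have "AE \<omega> in M. \<forall>n. \<not> \<xi> 1 \<omega> \<le> c - 1 / real (Suc n)" by (simp add: AE_all_countable)
    then have "AE \<omega> in M. \<not> \<xi> 1 \<omega> < c"
    proof eventually_elim
      case (elim \<omega>)
      show ?case
      proof
        assume "\<xi> 1 \<omega> < c"
        then obtain n where "1 / real (Suc n) < c - \<xi> 1 \<omega>"
          using nat_approx_posE[of "c - \<xi> 1 \<omega>"] by auto
        with elim[rule_format, of n] show False by linarith
      qed
    qed
    then have "\<P>(\<omega> in M. \<xi> 1 \<omega> < c) = 0" by (subst prob_eq_0) auto
    with assms(1) show False by simp
  qed
  then obtain n where n: "\<P>(\<omega> in M. \<xi> 1 \<omega> \<le> c - 1 / real (Suc n)) \<noteq> 0" by blast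
  let ?s = "max 0 (c - 1 / real (Suc n))"
  have "0 < \<P>(\<omega> in M. \<xi> 1 \<omega> \<le> c - 1 / real (Suc n))" using n by (simp add: zero_less_measure_iff)
  also have "\<dots> \<le> \<P>(\<omega> in M. \<xi> 1 \<omega> \<le> ?s)" by (intro finite_measure_mono) auto
  finally show ?thesis using assms(2) by (intro that[of ?s]) auto
qed

end

locale heavy_tailed_autoregression = autoregression +
  fixes F :: "real \<Rightarrow> real"
  assumes x0: "0 < x0"
    and strong_subexp: "F \<in> strong_subexponential"
    and log_insensitive: "0 < \<eta> \<Longrightarrow> \<forall>\<^sub>F y in at_top. tail F (y - ln y) \<le> (1 + \<eta>) * tail F y"
    and innovation_tail: "0 < b \<Longrightarrow> \<P>(\<omega> in M. b < \<xi> 1 \<omega>) = tail F (log (1 / a) b)"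
begin

abbreviation \<phi> :: "nat \<Rightarrow> real" where "\<phi> n \<equiv> tail F (real n)"

sublocale subexponential_sequence \<phi>
  using subexponential_sequence_tail strong_subexp log_insensitive by blast

lemma antimono_tail: "antimono (tail F)"
  using strong_subexp distribution_function_antimono_tail by (auto simp: strong_subexponential_def)

lemma tail_pos: "0 < tail F y"
  using strong_subexp by (auto simp: strong_subexponential_def)

lemma tail_shift:
  "0 < \<eta> \<Longrightarrow> \<forall>\<^sub>F y in at_top. tail F (y - C * ln y - c) \<le> (1 + \<eta>) * tail F y"
  by (rule tail_log_shift) (simp_all add: antimono_tail tail_pos log_insensitive)

text \<open>
  On the logarithmic scale \<open>r / (a\<^sup>j (j + 1)\<^sup>2)\<close> is \<open>j - O(log j)\<close>.
\<close>

lemma dominated_jump_tail: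
  assumes r: "0 < r"
  shows "dominated (jump_tail r)"
proof -
  have A: "1 < 1 / a" using a by simp
  then have lnA: "0 < ln (1 / a)" by (rule ln_gt_zero)
  have bound: "\<forall>\<^sub>F n in sequentially. jump_tail r n \<le> (1 + \<eta>) * \<phi> n" if \<eta>: "0 < \<eta>" for \<eta>
  proof -
    define C where "C = 4 / ln (1 / a)"
    have "\<forall>\<^sub>F n in sequentially. tail F (real n - C * ln (real n) - (- log (1 / a) r)) \<le> (1 + \<eta>) * \<phi> n"
      by (rule eventually_compose_filterlim[OF tail_shift[OF \<eta>] filterlim_real_sequentially])
    moreover have "\<forall>\<^sub>F n in sequentially. ln (real n + 1) \<le> 2 * ln (real n)" by real_asymp
    ultimately show ?thesis
    proof eventually_elim
      case (elim n)
      have "log (1 / a) (r / (a ^ n * (real n + 1)^2))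
          = log (1 / a) r + real n - 2 * log (1 / a) (real n + 1)"
      proof -
        have "r / (a ^ n * (real n + 1)^2) = r * (1 / a) ^ n / (real n + 1)^2"
          by (simp add: power_one_over)
        moreover have "log (1 / a) (r * (1 / a) ^ n / (real n + 1)^2)
            = log (1 / a) r + real n - 2 * log (1 / a) (real n + 1)"
          using r a A by (simp add: log_divide log_mult log_nat_power)
        ultimately show ?thesis by simp
      qed
      moreover have "2 * log (1 / a) (real n + 1) \<le> C * ln (real n)"
        using elim(2) lnA by (simp add: log_def C_def divide_simps)
      ultimately have "real n - C * ln (real n) - (- log (1 / a) r)
          \<le> log (1 / a) (r / (a ^ n * (real n + 1)^2))" by simp
      then have "tail F (log (1 / a) (r / (a ^ n * (real n + 1)^2)))
          \<le> tail F (real n - C * ln (real n) - (- log (1 / a) r))"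
        using antimono_tail by (rule antimonoD[rotated])
      also note elim(1)
      finally show ?case
        unfolding jump_tail_def by (subst innovation_tail) (use r a in auto)
    qed
  qed
  have "summable (jump_tail r)"
  proof (rule summable_comparison_test_ev)
    show "summable (\<lambda>n. 2 * \<phi> n)" using summable_tail[OF strong_subexp] by (rule summable_mult)
    show "\<forall>\<^sub>F n in sequentially. norm (jump_tail r n) \<le> 2 * \<phi> n"
      using bound[of 1] by (simp add: jump_tail_nonneg)
  qed
  with bound show ?thesis by (simp add: dominated_def jump_tail_nonneg)
qed

text \<open>
  The parameters are chosen in this order: \<open>s\<close> with \<open>s / (1 - a) < x0\<close>, so that small innovations push
  the chain below \<open>x0\<close> in the long run; the level \<open>R = 4 / a ^ i\<close>, so that the jump tail has mass at most
  \<open>\<epsilon>\<close>; and then \<open>m\<close>, the number of small innovations needed from \<open>R\<close>.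
\<close>

lemma surv_recursive_bound:
  assumes below: "0 < \<P>(\<omega> in M. a * x0 + \<xi> 1 \<omega> < x0)" and \<epsilon>: "0 < \<epsilon>"
  shows "recursive_bound surv \<epsilon>"
proof -
  have "\<P>(\<omega> in M. \<xi> 1 \<omega> < (1 - a) * x0) = \<P>(\<omega> in M. a * x0 + \<xi> 1 \<omega> < x0)"
    by (intro arg_cong[where f=prob]) (auto simp: algebra_simps)
  then obtain s where s: "0 \<le> s" "s < (1 - a) * x0" "0 < \<P>(\<omega> in M. \<xi> 1 \<omega> \<le> s)"
    using positive_mass_at_smaller_level[of "(1 - a) * x0"] below a x0 by auto
  have s': "s / (1 - a) < x0" using s(2) a by (simp add: field_simps)
  have sum1: "summable (jump_tail 1)" using dominated_jump_tail[of 1] by (simp add: dominated_def)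
  have "\<forall>\<^sub>F i in sequentially. (\<Sum>j. jump_tail 1 (j + i)) < \<epsilon>"
    using suminf_exist_split2[OF sum1] \<epsilon> by (intro order_tendstoD) auto
  then obtain i where i: "(\<Sum>j. jump_tail 1 (j + i)) < \<epsilon>" by (auto simp: eventually_sequentially)
  define f where "f = jump_tail (1 / a ^ i)"
  have f: "dominated f" unfolding f_def using a by (intro dominated_jump_tail) simp
  have "suminf f \<le> (\<Sum>j. jump_tail 1 (j + i))"
    using f sum1 jump_tail_shift[of i] by (intro suminf_le) (auto simp: f_def dominated_def)
  then have f\<epsilon>: "suminf f \<le> \<epsilon>" using i by simp
  define R where "R = 4 / a ^ i"
  have R: "0 < R" "R / 4 = 1 / a ^ i" using a by (auto simp: R_def)
  have "(\<lambda>m. a ^ m * R + s / (1 - a)) \<longlonglongrightarrow> 0 * R + s / (1 - a)"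
    using a by (intro tendsto_intros LIMSEQ_realpow_zero) auto
  then have "\<forall>\<^sub>F m in sequentially. a ^ m * R + s / (1 - a) < x0"
    using s' by (intro order_tendstoD) auto
  then have "\<forall>\<^sub>F m in sequentially. 0 < m \<and> a ^ m * R + s / (1 - a) \<le> x0"
    using eventually_gt_at_top[of 0] by eventually_elim simp
  then obtain m where m: "0 < m" "a ^ m * R + s / (1 - a) \<le> x0" by (auto simp: eventually_sequentially)
  define \<delta> where "\<delta> = \<P>(\<omega> in M. \<xi> 1 \<omega> \<le> s) ^ m"
  have \<delta>: "0 < \<delta>" "\<delta> \<le> 1" using s(3) by (auto simp: \<delta>_def power_le_one)
  have "(\<lambda>n. a ^ Suc n * x) \<longlonglongrightarrow> 0 * x"
    using a by (intro tendsto_intros LIMSEQ_Suc LIMSEQ_realpow_zero) auto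
  then have "\<forall>\<^sub>F n in sequentially. a ^ Suc n * x < R / 2"
    using R by (intro order_tendstoD) auto
  then have "\<forall>\<^sub>F n in sequentially. surv (n + Suc m) \<le> (1 - \<delta>) * surv n + \<delta> * (\<Sum>k\<le>n. surv k * f (n - k))"
  proof eventually_elim
    case (elim n)
    \<comment> \<open>Starting from \<open>n + 1\<close> aligns the indices of the convolution; \<open>surv\<close> is decreasing.\<close>
    have "surv (Suc n + m) \<le> (1 - \<delta>) * surv (Suc n) + \<delta> * (\<Sum>k<Suc n. surv k * f (Suc n - Suc k))"
      using surv_recursion[OF m(1) s(1) _ m(2), of "Suc n"] elim R
      by (simp only: \<delta>_def f_def jump_tail_def)
    also have "\<dots> \<le> (1 - \<delta>) * surv n + \<delta> * (\<Sum>k<Suc n. surv k * f (Suc n - Suc k))"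
      using \<delta> surv_antimono[of n "Suc n"] by (intro add_right_mono mult_left_mono) auto
    finally show ?case by (simp add: lessThan_Suc_atMost)
  qed
  with \<delta> f f\<epsilon> show ?thesis
    unfolding recursive_bound_def by (intro exI[of _ "Suc m"] exI[of _ \<delta>] exI[of _ f]) simp
qed

text \<open>
  Passing to the limit in \<open>surv_lower\<close> with \<open>b = x0 / a ^ n\<close>: a jump above this level has probability
  \<open>q n \<sim> \<phi> n\<close>, which tends to \<open>0\<close>.
\<close>

lemma surv_ratio_lower:
  obtains g where "g \<longlonglongrightarrow> (\<Sum>k<K. surv k)" "\<forall>\<^sub>F n in sequentially. g n \<le> surv n / \<phi> n"
proof -
  define c where "c = log (1 / a) x0"
  define q where "q n = tail F (real n + c)" for n :: nat
  have q0: "0 < q n" for n by (simp add: q_def tail_pos)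
  have up: "\<forall>\<^sub>F n in sequentially. q n / \<phi> n \<le> 1 + \<eta>" if "0 < \<eta>" for \<eta>
  proof -
    have "\<forall>\<^sub>F n in sequentially. tail F (real n - 0 * ln (real n) - (- c)) \<le> (1 + \<eta>) * \<phi> n"
      by (rule eventually_compose_filterlim[OF tail_shift[OF that] filterlim_real_sequentially])
    then show ?thesis
    proof eventually_elim
      case (elim n)
      then show ?case using pos[of n] by (simp add: q_def field_simps)
    qed
  qed
  have lo: "\<forall>\<^sub>F n in sequentially. 1 / (1 + \<eta>) \<le> q n / \<phi> n" if "0 < \<eta>" for \<eta>
  proof -
    have lim: "filterlim (\<lambda>n. real n + c) at_top sequentially" by real_asymp
    have "\<forall>\<^sub>F n in sequentially. tail F ((real n + c) - 0 * ln (real n + c) - c) \<le> (1 + \<eta>) * tail F (real n + c)"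
      by (rule eventually_compose_filterlim[OF tail_shift[OF that] lim])
    then show ?thesis
    proof eventually_elim
      case (elim n)
      then show ?case using pos[of n] that by (simp add: q_def field_simps)
    qed
  qed
  have ratio: "(\<lambda>n. q n / \<phi> n) \<longlonglongrightarrow> 1"
  proof (rule order_tendstoI)
    fix u :: real assume u: "1 < u"
    have "\<forall>\<^sub>F n in sequentially. q n / \<phi> n \<le> 1 + (u - 1) / 2" using u by (intro up) simp
    moreover have "1 + (u - 1) / 2 < u" using u by (simp add: field_simps)
    ultimately show "\<forall>\<^sub>F n in sequentially. q n / \<phi> n < u" by (auto elim: eventually_mono)
  next
    fix u :: real assume u: "u < 1"
    define v where "v = max u (1/2)"
    have v: "u \<le> v" "0 < v" "v < 1" using u by (auto simp: v_def)
    define e where "e = (1 / v - 1) / 2"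
    have "1 < 1 / v" using v by simp
    then have e: "0 < e" "1 + e < 1 / v" by (auto simp: e_def field_simps)
    then have "v < 1 / (1 + e)" using v by (simp add: field_simps)
    then show "\<forall>\<^sub>F n in sequentially. u < q n / \<phi> n"
      using lo[OF e(1)] v(1) by (auto elim!: eventually_mono)
  qed
  have "(\<lambda>n. q n / \<phi> n * \<phi> n) \<longlonglongrightarrow> 1 * 0"
    using ratio summable_LIMSEQ_zero[OF summable_tail[OF strong_subexp]] by (rule tendsto_mult)
  moreover have "(\<lambda>n. q n / \<phi> n * \<phi> n) = q" using pos by (auto simp: fun_eq_iff less_imp_neq[THEN not_sym])
  ultimately have qlim: "q \<longlonglongrightarrow> 0" by simp
  let ?g = "\<lambda>n. \<Sum>k<K. (surv k - real k * q n) * (q n / \<phi> n)"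
  have "?g \<longlonglongrightarrow> (\<Sum>k<K. (surv k - real k * 0) * 1)"
    using ratio qlim by (intro tendsto_intros)
  moreover have "\<forall>\<^sub>F n in sequentially. ?g n \<le> surv n / \<phi> n"
    using eventually_ge_at_top[of K]
  proof eventually_elim
    case (elim n)
    have A: "1 < 1 / a" using a by simp
    have "x0 / a ^ n = x0 * (1 / a) ^ n" by (simp add: power_one_over)
    then have "log (1 / a) (x0 / a ^ n) = real n + c"
      using x0 a A by (simp add: log_mult log_nat_power c_def)
    then have "\<P>(\<omega> in M. x0 / a ^ n < \<xi> 1 \<omega>) = q n"
      using x0 a by (subst innovation_tail) (auto simp: q_def)
    then have "(\<Sum>k<K. (surv k - real k * q n) * q n) \<le> surv n"
      using surv_lower[OF elim order_refl] x0 a by simp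
    then have "(\<Sum>k<K. (surv k - real k * q n) * q n) / \<phi> n \<le> surv n / \<phi> n"
      using pos[of n] by (intro divide_right_mono) auto
    then show ?case by (simp add: sum_divide_distrib)
  qed
  ultimately show ?thesis by (intro that[of ?g]) auto
qed

lemma surv_ratio_at_top:
  assumes "\<not> summable surv"
  shows "filterlim (\<lambda>n. surv n / \<phi> n) at_top sequentially"
  unfolding filterlim_at_top
proof
  fix Z :: real
  obtain K where K: "Z < (\<Sum>k<K. surv k)"
  proof (rule ccontr)
    assume "\<not> thesis"
    then have "(\<Sum>k\<le>n. surv k) \<le> Z" for n using that[of "Suc n"] by (force simp: lessThan_Suc_atMost)
    then have "summable surv" by (intro bounded_imp_summable surv_nonneg)
    with assms show False by simp
  qed
  obtain g where g: "g \<longlonglongrightarrow> (\<Sum>k<K. surv k)" "\<forall>\<^sub>F n in sequentially. g n \<le> surv n / \<phi> n"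
    by (rule surv_ratio_lower)
  have "\<forall>\<^sub>F n in sequentially. Z < g n" using g(1) K by (rule order_tendstoD)
  with g(2) show "\<forall>\<^sub>F n in sequentially. Z \<le> surv n / \<phi> n" by eventually_elim simp
qed

lemma surv_ratio_tendsto:
  assumes below: "0 < \<P>(\<omega> in M. a * x0 + \<xi> 1 \<omega> < x0)"
  shows "summable surv" "(\<lambda>n. surv n / \<phi> n) \<longlonglongrightarrow> suminf surv"
proof -
  show sm: "summable surv"
    using recursive_bound_summable surv_nonneg surv_recursive_bound[OF below] by simp
  show "(\<lambda>n. surv n / \<phi> n) \<longlonglongrightarrow> suminf surv"
  proof (rule order_tendstoI)
    fix u assume u: "suminf surv < u"
    have "\<forall>\<^sub>F n in sequentially. surv n \<le> (suminf surv + (u - suminf surv) / 2) * \<phi> n"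
      using u by (intro recursive_bound_limsup surv_nonneg surv_recursive_bound below) auto
    then show "\<forall>\<^sub>F n in sequentially. surv n / \<phi> n < u"
    proof eventually_elim
      case (elim n)
      then have "surv n / \<phi> n \<le> suminf surv + (u - suminf surv) / 2"
        using pos[of n] by (simp add: pos_divide_le_eq)
      also have "\<dots> < u" using u by (simp add: field_simps)
      finally show ?case .
    qed
  next
    fix u assume "u < suminf surv"
    then have "\<forall>\<^sub>F K in sequentially. u < (\<Sum>k<K. surv k)"
      using summable_LIMSEQ[OF sm] by (intro order_tendstoD)
    then obtain K where K: "u < (\<Sum>k<K. surv k)" by (auto simp: eventually_sequentially)
    obtain g where g: "g \<longlonglongrightarrow> (\<Sum>k<K. surv k)" "\<forall>\<^sub>F n in sequentially. g n \<le> surv n / \<phi> n"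
      by (rule surv_ratio_lower)
    have "\<forall>\<^sub>F n in sequentially. u < g n" using g(1) K by (rule order_tendstoD)
    with g(2) show "\<forall>\<^sub>F n in sequentially. u < surv n / \<phi> n" by eventually_elim simp
  qed
qed

end

theorem theorem6:
  fixes M :: "'w measure" and \<xi> \<eta> :: "nat \<Rightarrow> 'w \<Rightarrow> real"
    and a A x0 x :: real and F :: "real \<Rightarrow> real"
    and T :: "'w \<Rightarrow> enat" and ET :: ennreal
  assumes "prob_space M"
    and "0 < a" and "a < 1" and "A = 1 / a"
    and "prob_space.indep_vars M (\<lambda>_. borel) \<xi> {1..}"
    and "\<And>n. 1 \<le> n \<Longrightarrow> distr M borel (\<xi> n) = distr M borel (\<xi> 1)"
    and "\<And>n. 1 \<le> n \<Longrightarrow> AE \<omega> in M. 0 < \<xi> n \<omega>"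
    and "\<And>n \<omega>. \<eta> n \<omega> = log A (\<xi> n \<omega>)"
    and "\<And>y. F y = \<P>(\<omega> in M. \<eta> 1 \<omega> \<le> y)"
    and "0 < \<P>(\<omega> in M. a * x0 + \<xi> 1 \<omega> \<le> x0)"
    and "(\<integral>\<^sup>+ \<omega>. ennreal (max 0 (\<eta> 1 \<omega>)) \<partial>M) < \<infinity>"
    and "F \<in> strong_subexponential"
    and "asymp_equiv (\<lambda>y::real. \<P>(\<omega> in M. \<eta> 1 \<omega> > y)) at_top
                     (\<lambda>y. \<P>(\<omega> in M. \<eta> 1 \<omega> > y - ln y))"
    and "x0 < x"
    and "T = hitting_time (ar_chain a \<xi> x) x0"
    and "ET = (\<integral>\<^sup>+ \<omega>. ennreal_of_enat (T \<omega>) \<partial>M)"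
  shows "((\<lambda>n::nat. ennreal (\<P>(\<omega> in M. T \<omega> > enat n)) / ennreal (\<P>(\<omega> in M. \<eta> 1 \<omega> > real n)))
            \<longlonglongrightarrow> ET)
       \<and> (0 < \<P>(\<omega> in M. a * x0 + \<xi> 1 \<omega> < x0) \<longrightarrow>
            ET < \<infinity> \<and>
            asymp_equiv (\<lambda>n::nat. \<P>(\<omega> in M. T \<omega> > enat n)) sequentially
                        (\<lambda>n. enn2real ET * \<P>(\<omega> in M. \<eta> 1 \<omega> > real n)))"
proof -
  interpret prob_space M by fact
  interpret autoregression M \<xi> a x0 x
    by unfold_locales (fact assms(2,3,5,14) | erule assms(6) | erule assms(7))+
  have A: "1 < A" using assms(2-4) by simp
  have xi_pos: "AE \<omega> in M. 0 < \<xi> 1 \<omega>" using assms(7) by simp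
  have [measurable]: "\<xi> 1 \<in> borel_measurable M" using innovation_measurable[of 0] by simp
  have eta_eq: "\<eta> 1 = (\<lambda>\<omega>. log A (\<xi> 1 \<omega>))" using assms(8) by (rule ext)
  have [measurable]: "\<eta> 1 \<in> borel_measurable M" unfolding eta_eq by measurable
  have tail_eq: "\<P>(\<omega> in M. y < \<eta> 1 \<omega>) = tail F y" for y
  proof -
    have "{\<omega>\<in>space M. y < \<eta> 1 \<omega>} = space M - {\<omega>\<in>space M. \<eta> 1 \<omega> \<le> y}" by auto
    moreover have "{\<omega>\<in>space M. \<eta> 1 \<omega> \<le> y} \<in> events" by measurable
    ultimately show ?thesis by (simp only: tail_def assms(9) prob_compl)
  qed
  have x0: "0 < x0"
  proof (rule ccontr)
    assume "\<not> 0 < x0"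
    then have "(1 - a) * x0 \<le> 0" using assms(3) by (simp add: mult_nonneg_nonpos)
    then have "AE \<omega> in M. \<not> a * x0 + \<xi> 1 \<omega> \<le> x0"
      using xi_pos by (auto simp: algebra_simps elim!: eventually_mono)
    then have "\<P>(\<omega> in M. a * x0 + \<xi> 1 \<omega> \<le> x0) = 0" by (subst prob_eq_0) auto
    then show False using assms(10) by simp
  qed
  have tail_pos': "0 < tail F y" for y using assms(12) by (auto simp: strong_subexponential_def)
  interpret heavy_tailed_autoregression M \<xi> a x0 x F
  proof unfold_locales
    show "0 < x0" "F \<in> strong_subexponential" by fact+
    show "\<P>(\<omega> in M. b < \<xi> 1 \<omega>) = tail F (log (1 / a) b)" if "0 < b" for b
    proof -
      have "\<P>(\<omega> in M. b < \<xi> 1 \<omega>) = \<P>(\<omega> in M. log A b < \<eta> 1 \<omega>)"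
      proof (rule finite_measure_eq_AE)
        show "AE \<omega> in M. \<omega> \<in> {\<omega>\<in>space M. b < \<xi> 1 \<omega>} \<longleftrightarrow> \<omega> \<in> {\<omega>\<in>space M. log A b < \<eta> 1 \<omega>}"
          using xi_pos by eventually_elim (use A that in \<open>simp add: assms(8)\<close>)
      qed measurable
      also have "\<dots> = tail F (log A b)" by (rule tail_eq)
      finally show ?thesis by (simp only: assms(4))
    qed
    show "\<forall>\<^sub>F y in at_top. tail F (y - ln y) \<le> (1 + e) * tail F y" if e: "0 < e" for e
    proof -
      have "((\<lambda>y. tail F y / tail F (y - ln y)) \<longlongrightarrow> 1) at_top"
        using assms(13) tail_pos' unfolding asymp_equiv_def tail_eq by (simp add: less_imp_neq[THEN not_sym])
      then have "\<forall>\<^sub>F y in at_top. 1 / (1 + e) < tail F y / tail F (y - ln y)"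
        using e by (intro order_tendstoD) auto
      then show ?thesis
      proof eventually_elim
        case (elim y)
        then show ?case using tail_pos'[of "y - ln y"] e by (simp add: field_simps)
      qed
    qed
  qed
  have surv_eq: "\<P>(\<omega> in M. enat n < T \<omega>) = surv n" for n
    by (simp add: assms(15) less_hitting_time_iff surv_def survives_def)
  have ET: "ET = (\<Sum>n. ennreal (surv n))" unfolding assms(15,16) by (rule mean_hitting_time)
  have ratio: "ennreal (surv n) / ennreal (tail F (real n)) = ennreal (surv n / tail F (real n))" for n
    by (rule divide_ennreal) (simp_all add: surv_nonneg tail_pos)
  show ?thesis
  proof (cases "0 < \<P>(\<omega> in M. a * x0 + \<xi> 1 \<omega> < x0)")
    case True
    note lim = surv_ratio_tendsto[OF True]
    have ET': "ET = ennreal (suminf surv)"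
      unfolding ET using surv_nonneg lim(1) by (intro suminf_ennreal2)
    have "(\<Sum>n<1. surv n) \<le> suminf surv" using lim(1) surv_nonneg by (intro sum_le_suminf) auto
    then have S: "1 \<le> suminf surv" by (simp add: surv_0)
    have "(\<lambda>n. surv n / tail F (real n) / suminf surv) \<longlonglongrightarrow> suminf surv / suminf surv"
      using lim(2) S by (intro tendsto_intros) auto
    then have "asymp_equiv surv sequentially (\<lambda>n. suminf surv * tail F (real n))"
      using S by (intro asymp_equivI') (simp add: mult.commute)
    moreover have "(\<lambda>n. ennreal (surv n / tail F (real n))) \<longlonglongrightarrow> ennreal (suminf surv)"
      using lim(2) by (rule tendsto_ennrealI)
    ultimately show ?thesis
      using S unfolding surv_eq tail_eq ratio ET' by simp
  next
    case False
    then have "\<P>(\<omega> in M. a * x0 + \<xi> 1 \<omega> < x0) = 0" by (simp add: zero_less_measure_iff)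
    then have surv1: "surv n = 1" for n by (rule surv_eq_1_if_never_below)
    have ns: "\<not> summable surv"
    proof -
      have "surv = (\<lambda>_. 1)" by (rule ext) (rule surv1)
      then show ?thesis by (simp add: summable_const_iff)
    qed
    have "ET = top"
    proof (rule ccontr)
      assume "ET \<noteq> top"
      then have "summable surv" unfolding ET using surv_nonneg summable_suminf_not_top by blast
      with ns show False by simp
    qed
    moreover have "(\<lambda>n. ennreal (surv n / tail F (real n))) \<longlonglongrightarrow> top"
      using surv_ratio_at_top[OF ns] by (simp add: ennreal_tendsto_top_eq_at_top)
    ultimately show ?thesis using False unfolding surv_eq tail_eq ratio by simp
  qed
qed

end
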